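(* For every $1<q\le2$ there is a constant $C_q>0$ such that for every closed, constant speed curve $\gamma:\mathbb T^1\to\mathbb R^3$ with finite distortion and finite scale-invariant total $q$-curvature, $$\bar c(\gamma)\le C_q\,\bar\kappa_q^2(\gamma)\,\delta_\infty^3(\gamma).$$ In particular ($q=2$), $\bar c(\gamma)\le C_2\,\delta_\infty^3(\gamma)\,E_{\mathrm b}(\gamma)$, where $E_{\mathrm b}(\gamma)=\bar\kappa_2^2(\gamma)$ is the scale-invariant bending energy.
   Context: $\mathbb T^1$ is $[-\pi,\pi]$ with endpoints identified. $\mathrm{len}(\gamma)=\int_{\mathbb T^1}|\gamma'|dx$, and constant speed means $|\gamma'|\equiv\mathrm{len}(\gamma)/2\pi$. The distortion $\delta_\infty(\gamma)$ is the supremum over distinct points of the curve of the ratio of arc-length distance along the curve to Euclidean distance. With $\kappa_\gamma$ the pointwise curvature (for constant speed curves $\kappa_\gamma(x)=4\pi^2|\gamma''(x)|/\mathrm{len}(\gamma)^2$), the scale-invariant total $q$-curvature is $$\bar\kappa_q(\gamma)=\left(\frac{\mathrm{len}(\gamma)}{2\pi}\right)^{1-\frac1q}\left(\frac1{2\pi}\int_{\mathbb T^1}\kappa_\gamma^q(x)|\gamma'(x)|\,dx\right)^{\frac1q},$$ and $E_{\mathrm b}(\gamma)=\frac{\mathrm{len}(\gamma)}{2\pi}\cdot\frac1{2\pi}\int_{\mathbb T^1}\kappa_\gamma^2|\gamma'|\,dx$. The average crossing number is $\bar c(\gamma)=\frac1{8\pi}\int_{\mathcal S^2}|C_\gamma(\sigma)|\,d\sigma$,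 where $\mathcal S^2$ is the unit sphere with surface measure, $C_\gamma(\sigma)=\{(x,z)\in\mathbb T^1\times\mathbb T^1:(P_\sigma\gamma)(x)=(P_\sigma\gamma)(x+z),\ z\ne0\}$, $P_\sigma\gamma=\gamma-\langle\gamma,\sigma\rangle\sigma$ is orthogonal projection onto $\sigma^\perp$, and $|\cdot|$ is cardinality. *)

theory Defs
  imports "HOL-Analysis.Analysis"
begin

text \<open>
  The circle of length \<open>2 * pi\<close> is represented by the fundamental domain \<open>{-pi..<pi}\<close>, and curves on it
  by \<open>2 * pi\<close>-periodic functions on the real line.
\<close>

abbreviation circle :: "real set" where
  "circle \<equiv> {-pi..<pi}"

definition velocity :: "(real \<Rightarrow> real^3) \<Rightarrow> real \<Rightarrow> real^3" where
  "velocity \<gamma> x = vector_derivative \<gamma> (at x)"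

definition acceleration :: "(real \<Rightarrow> real^3) \<Rightarrow> real \<Rightarrow> real^3" where
  "acceleration \<gamma> x = vector_derivative (velocity \<gamma>) (at x)"

definition len :: "(real \<Rightarrow> real^3) \<Rightarrow> real" where
  "len \<gamma> = (LINT x:circle|lebesgue. norm (velocity \<gamma> x))"

text \<open>
  Point curves (\<open>len \<gamma> = 0\<close>) are excluded: the curvature and the distortion ratios are not
  defined for them.
\<close>

definition closed_constant_speed_curve :: "(real \<Rightarrow> real^3) \<Rightarrow> bool" where
  "closed_constant_speed_curve \<gamma> \<longleftrightarrow>
     (\<forall>x. \<gamma> (x + 2 * pi) = \<gamma> x) \<and>
     (\<forall>x. \<gamma> differentiable (at x)) \<and>
     0 < len \<gamma> \<and>
     (\<forall>x. norm (velocity \<gamma> x) = len \<gamma> / (2 * pi))"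

text \<open>
  The arc-length distance is the length of the shorter of the two arcs joining two points. The
  distortion is taken over distinct parameters and is valued in the extended nonnegative reals,
  where \<open>a / 0 = \<infinity>\<close> for \<open>a > 0\<close>: a self-intersecting curve has infinite distortion.
\<close>

definition arc_distance :: "(real \<Rightarrow> real^3) \<Rightarrow> real \<Rightarrow> real \<Rightarrow> real" where
  "arc_distance \<gamma> x y =
     (let l = (LINT t:{min x y..max x y}|lebesgue. norm (velocity \<gamma> t)) in min l (len \<gamma> - l))"

definition distortion :: "(real \<Rightarrow> real^3) \<Rightarrow> ennreal" where
  "distortion \<gamma> =
     (SUP (x, y) \<in> {(x, y). x \<in> circle \<and> y \<in> circle \<and> x \<noteq> y}.
        ennreal (arc_distance \<gamma> x y) / ennreal (dist (\<gamma> x) (\<gamma> y)))"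

text \<open>This is the formula for the curvature of constant speed curves.\<close>

definition curvature :: "(real \<Rightarrow> real^3) \<Rightarrow> real \<Rightarrow> real" where
  "curvature \<gamma> x = 4 * pi\<^sup>2 * norm (acceleration \<gamma> x) / (len \<gamma>)\<^sup>2"

definition total_curvature :: "real \<Rightarrow> (real \<Rightarrow> real^3) \<Rightarrow> real" where
  "total_curvature q \<gamma> =
     (len \<gamma> / (2 * pi)) powr (1 - 1 / q) *
     (1 / (2 * pi) *
        (LINT x:circle|lebesgue. curvature \<gamma> x powr q * norm (velocity \<gamma> x))) powr (1 / q)"

text \<open>
  The curvature of \<open>\<gamma>\<close> is a function only if \<open>\<gamma>\<close> has a second weak derivative, that is, if its
  velocity is absolutely continuous. The latter is expressed by the fundamental theorem of
  calculus; without it, a curve turning like a Cantor function would have total curvature zero.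
  Together with the integrability of the \<open>q\<close>-th power of the
  curvature this says that \<open>\<gamma>\<close> is in the Sobolev space \<open>W\<^sup>2\<^sup>,\<^sup>q\<close>.
\<close>

definition finite_total_curvature :: "real \<Rightarrow> (real \<Rightarrow> real^3) \<Rightarrow> bool" where
  "finite_total_curvature q \<gamma> \<longleftrightarrow>
     (\<forall>a b. a \<le> b \<longrightarrow>
        set_integrable lebesgue {a..b} (acceleration \<gamma>) \<and>
        velocity \<gamma> b - velocity \<gamma> a = (LINT t:{a..b}|lebesgue. acceleration \<gamma> t)) \<and>
     set_integrable lebesgue circle (\<lambda>x. curvature \<gamma> x powr q * norm (velocity \<gamma> x))"

definition bending_energy :: "(real \<Rightarrow> real^3) \<Rightarrow> real" where
  "bending_energy \<gamma> =
     len \<gamma> / (2 * pi) *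
     (1 / (2 * pi) * (LINT x:circle|lebesgue. (curvature \<gamma> x)\<^sup>2 * norm (velocity \<gamma> x)))"

text \<open>
  Surface measure on the unit sphere: the measure of \<open>A\<close> is three times the volume of the cone
  over \<open>A\<close> inside the unit ball (polar coordinates, \<open>1 = 3 * \<integral>\<^sub>0\<^sup>1 r\<^sup>2 dr\<close>).
\<close>

definition sphere_measure :: "(real^3) measure" where
  "sphere_measure =
     scale_measure 3
       (distr (restrict_space lborel (ball 0 1 - {0})) (restrict_space borel (sphere 0 1))
          (\<lambda>x. x /\<^sub>R norm x))"

lemma emeasure_sphere_measure_space:
  "emeasure sphere_measure (space sphere_measure) = ennreal (4 * pi)"
proof -
  let ?B = "ball 0 1 - {0 :: real^3}"
  have meas: "(\<lambda>x. x /\<^sub>R norm x) \<in> restrict_space lborel ?B \<rightarrow>\<^sub>M restrict_space borel (sphere 0 1)"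
    by (intro measurable_restrict_space3) auto
  have vol: "emeasure lborel ?B = ennreal (4 / 3 * pi)"
  proof -
    have "emeasure lborel ?B = emeasure lborel (ball (0 :: real^3) 1)"
      by (rule emeasure_Diff_null_set) (auto simp: null_sets_def)
    also have "\<dots> = ennreal (4 / 3 * pi)"
      by (simp add: emeasure_ball unit_ball_vol_3)
    finally show ?thesis .
  qed
  have "emeasure (distr (restrict_space lborel ?B) (restrict_space borel (sphere 0 1))
          (\<lambda>x. x /\<^sub>R norm x)) (sphere 0 1) = emeasure (restrict_space lborel ?B) ?B"
    by (subst emeasure_distr[OF meas])
       (auto simp: sets_restrict_space space_restrict_space intro!: arg_cong[where f = "emeasure _"])
  also have "\<dots> = ennreal (4 / 3 * pi)"
    using vol by (subst emeasure_restrict_space) auto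
  finally show ?thesis
    by (simp add: sphere_measure_def space_scale_measure space_restrict_space
        ennreal_mult[symmetric] flip: ennreal_numeral)
qed

definition proj_perp :: "real^3 \<Rightarrow> real^3 \<Rightarrow> real^3" where
  "proj_perp \<sigma> v = v - (v \<bullet> \<sigma>) *\<^sub>R \<sigma>"

definition crossings :: "(real \<Rightarrow> real^3) \<Rightarrow> real^3 \<Rightarrow> (real \<times> real) set" where
  "crossings \<gamma> \<sigma> =
     {(x, z). x \<in> circle \<and> z \<in> circle \<and> z \<noteq> 0 \<and>
        proj_perp \<sigma> (\<gamma> x) = proj_perp \<sigma> (\<gamma> (x + z))}"

text \<open>The counting measure gives the cardinality \<open>\<infinity>\<close> to infinite sets, where \<open>card\<close> would give 0.\<close>

definition average_crossing_number :: "(real \<Rightarrow> real^3) \<Rightarrow> ennreal" where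
  "average_crossing_number \<gamma> =
     (\<integral>\<^sup>+\<sigma>. emeasure (count_space UNIV) (crossings \<gamma> \<sigma>) \<partial>sphere_measure) / ennreal (8 * pi)"

end

theory Submission
  imports Defs
begin

text \<open>
  A pair \<open>(x, z)\<close> is a crossing in direction \<open>\<sigma>\<close> exactly when the chord
  \<open>D (x, z) = \<gamma> (x + z) - \<gamma> x\<close> is parallel to \<open>\<sigma>\<close>. Averaging the number of crossings over the sphere
  thus means integrating the multiplicity of the map \<open>\<plusminus>D / \<bar>D\<bar>\<close>, and the area formula turns this into an
  integral of its Jacobian \<open>\<bar>det (D, \<gamma>' (x + z), \<gamma>' x)\<bar> / \<bar>D\<bar>\<^sup>3\<close>.

  To stay in linear coordinates the sphere is thickened to the unit ball, which is also how its
  surface measure is defined. The points \<open>p\<close> of the ball lying over \<open>\<sigma>\<close> are covered by the map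
  \<open>(z, x, r) \<mapsto> r D (x, z)\<close> of \<open>\<real>\<^sup>3\<close> (\<open>secant_map\<close>), and each is attained at least as often as
  there are crossings in direction \<open>\<sigma>\<close> (\<open>emeasure_crossings_le\<close>). For an upper bound it suffices to integrate these
  multiplicities in \<open>\<real>\<^sup>n\<close> against the Jacobian determinant (\<open>area_inequality\<close>). The distortion \<open>\<delta>\<close>
  enters through \<open>v \<bar>z\<bar> \<le> \<delta> \<bar>D\<bar>\<close>, where \<open>v\<close> is the speed: it confines \<open>r\<close> to
  \<open>\<bar>r\<bar> \<le> \<delta> / (v \<bar>z\<bar>)\<close>, and the integral of \<open>r\<^sup>2\<close> over this range produces \<open>\<delta>\<^sup>3\<close>.

  The determinant is small near the diagonal for two reasons at once: in
  \<open>det (D, \<gamma>' (x + z), \<gamma>' x)\<close> one may subtract \<open>z \<gamma>' (x + z)\<close> from the first and \<open>\<gamma>' (x + z)\<close> from the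
  last column. Both differences are controlled by the integral \<open>A\<close> of \<open>\<bar>\<gamma>''\<bar>\<close> over the arc from \<open>x\<close> to
  \<open>x + z\<close>, so the determinant is at most \<open>v \<bar>z\<bar> A\<^sup>2\<close> (\<open>triple_product_secant_le\<close>). By the power mean
  inequality \<open>A\<^sup>2\<close> is bounded by \<open>\<bar>z\<bar> powr (2 - 2 / q)\<close> times a power of the total integral of
  \<open>\<bar>\<gamma>''\<bar> powr q\<close> times the integral of \<open>\<bar>\<gamma>''\<bar> powr q\<close> over that arc. Keeping the last factor local is
  essential: its integral over \<open>x\<close> gains another \<open>\<bar>z\<bar>\<close>, which leaves
  \<open>\<bar>z\<bar> powr (1 - 2 / q)\<close>, and this is integrable at \<open>0\<close> precisely because \<open>q > 1\<close>
  (\<open>nn_integral_majorant_le\<close>).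
\<close>

section \<open>An area inequality with multiplicities\<close>

text \<open>
  The cubes of side \<open>1 / n\<close> form a countable partition of the space; numbering them by naturals
  makes sums over the cells ordinary series.
\<close>
definition grid_cell :: "nat \<Rightarrow> real^'n \<Rightarrow> nat" where
  "grid_cell n x = to_nat (\<chi> i. \<lfloor>real n * x $ i\<rfloor>)"

lemma measurable_grid_cell: "grid_cell n -` {k} \<in> sets (borel :: (real^'n) measure)"
proof -
  have "(\<lambda>x :: real^'n. \<lfloor>real n * x $ i\<rfloor>) \<in> borel \<rightarrow>\<^sub>M count_space UNIV" for i
    by measurable
  then have *: "(\<lambda>x :: real^'n. \<lfloor>real n * x $ i\<rfloor>) -` {j} \<inter> space borel \<in> sets borel" for i j
    by (rule measurable_sets) simp
  have "{x :: real^'n. \<lfloor>real n * x $ i\<rfloor> = j} \<in> sets borel" for i j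
    using *[of i j] by (simp add: vimage_def)
  then have "(\<Inter>i. {x :: real^'n. \<lfloor>real n * x $ i\<rfloor> = v $ i}) \<in> sets borel" for v
    by (intro sets.finite_INT) auto
  moreover have "grid_cell n -` {k} = (\<Union>v \<in> {v. to_nat v = k}. \<Inter>i. {x :: real^'n. \<lfloor>real n * x $ i\<rfloor> = v $ i})"
  proof -
    have "grid_cell n x = k \<longleftrightarrow> (\<exists>v. to_nat v = k \<and> (\<forall>i. \<lfloor>real n * x $ i\<rfloor> = v $ i))" for x :: "real^'n"
      unfolding grid_cell_def
      by (auto simp: vec_eq_iff intro!: exI[of _ "\<chi> i. \<lfloor>real n * x $ i\<rfloor>"] arg_cong[where f = to_nat])
    then show ?thesis unfolding vimage_def by blast
  qed
  ultimately show ?thesis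
    by (metis (no_types, lifting) countableI_type sets.countable_UN'' )
qed

lemma eventually_grid_cell_neq:
  assumes "x \<noteq> y"
  shows "eventually (\<lambda>n. grid_cell n x \<noteq> grid_cell n y) sequentially"
proof -
  obtain i where i: "x $ i \<noteq> y $ i" using assms by (auto simp: vec_eq_iff)
  obtain N :: nat where N: "1 / \<bar>x $ i - y $ i\<bar> < real N"
    using reals_Archimedean2 by blast
  show ?thesis
  proof (rule eventually_sequentiallyI[of N])
    fix n assume "N \<le> n"
    then have "1 / \<bar>x $ i - y $ i\<bar> < real n" using N by simp
    then have "1 < real n * \<bar>x $ i - y $ i\<bar>" using i by (simp add: field_simps)
    then have "1 < \<bar>real n * x $ i - real n * y $ i\<bar>"
      by (simp add: abs_mult flip: right_diff_distrib)
    then have "\<lfloor>real n * x $ i\<rfloor> \<noteq> \<lfloor>real n * y $ i\<rfloor>" by linarith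
    then show "grid_cell n x \<noteq> grid_cell n y"
      by (auto simp: grid_cell_def vec_eq_iff)
  qed
qed

text \<open>
  Finitely many preimages of \<open>p\<close> lie in different cells once the grid is fine enough. The number of
  cells whose image contains \<open>p\<close> is a sum of indicators of images, so its integral is a sum of
  measures of images.
\<close>
lemma count_le_liminf_grid_cells:
  fixes S :: "(real^'n) set"
  shows "emeasure (count_space UNIV) {x \<in> S. f x = p}
    \<le> liminf (\<lambda>n. \<Sum>k. indicator (f ` (S \<inter> grid_cell n -` {k})) p)"
    (is "_ \<le> liminf ?N")
proof -
  let ?F = "{x \<in> S. f x = p}"
  have fin: "of_nat (card A) \<le> liminf ?N" if A: "A \<subseteq> ?F" "finite A" for A
  proof (rule Liminf_bounded)
    have "eventually (\<lambda>n. \<forall>x\<in>A. \<forall>y\<in>A - {x}. grid_cell n x \<noteq> grid_cell n y) sequentially"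
      using A by (auto intro!: eventually_ball_finite eventually_grid_cell_neq)
    then show "eventually (\<lambda>n. of_nat (card A) \<le> ?N n) sequentially"
    proof eventually_elim
      case (elim n)
      then have inj: "inj_on (grid_cell n) A" by (auto simp: inj_on_def)
      have "of_nat (card A) = (\<Sum>k\<in>grid_cell n ` A. 1 :: ennreal)"
        using inj by (simp add: card_image)
      also have "\<dots> \<le> (\<Sum>k\<in>grid_cell n ` A. indicator (f ` (S \<inter> grid_cell n -` {k})) p)"
        using A by (intro sum_mono) (force simp: indicator_def)
      also have "\<dots> \<le> ?N n"
        using A by (intro sum_le_suminf) auto
      finally show ?case .
    qed
  qed
  show ?thesis
  proof (cases "finite ?F")
    case True
    then show ?thesis using fin[of ?F] by (simp add: emeasure_count_space)
  next
    case False
    have "liminf ?N = top"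
    proof (rule ccontr)
      assume "liminf ?N \<noteq> top"
      then have "liminf ?N < top"
        by (rule top.not_eq_extremum[THEN iffD1])
      then obtain k where k: "liminf ?N < of_nat k"
        using ennreal_Ex_less_of_nat by blast
      obtain A where A: "finite A" "card A = k" "A \<subseteq> ?F"
        using infinite_arbitrarily_large[OF False, of k] by blast
      have "of_nat k \<le> liminf ?N" using fin[OF A(3,1)] unfolding A(2) .
      then show False using k leD by blast
    qed
    then show ?thesis by (simp only: top_greatest)
  qed
qed

lemma differentiable_image_lebesgue:
  fixes f :: "real^'n::{finite,wellorder} \<Rightarrow> real^'n::_"
  assumes S: "S \<in> sets lebesgue"
    and f: "\<And>x. x \<in> S \<Longrightarrow> (f has_derivative f' x) (at x within S)"
    and fin: "(\<integral>\<^sup>+x. ennreal \<bar>det (matrix (f' x))\<bar> * indicator S x \<partial>lebesgue) < \<infinity>"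
  shows "f ` S \<in> sets lebesgue"
    and "emeasure lebesgue (f ` S) \<le> (\<integral>\<^sup>+x. ennreal \<bar>det (matrix (f' x))\<bar> * indicator S x \<partial>lebesgue)"
proof -
  let ?J = "\<lambda>x. \<bar>det (matrix (f' x))\<bar>"
  have meas: "?J \<in> borel_measurable (lebesgue_on S)"
    using borel_measurable_det_Jacobian[OF S f] by measurable
  have "(\<integral>\<^sup>+x. ennreal (?J x) \<partial>lebesgue_on S) < \<infinity>"
    using fin S by (simp add: nn_integral_restrict_space)
  then have "integrable (lebesgue_on S) ?J"
    using meas by (simp add: integrable_iff_bounded)
  then have int: "?J integrable_on S" and eq: "integral S ?J = (LINT x|lebesgue_on S. ?J x)"
    using S by (auto intro: integrable_on_lebesgue_on lebesgue_integral_eq_integral[symmetric])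
  have "f ` S \<in> lmeasurable" using measurable_differentiable_image[OF S f int] by simp
  then show "f ` S \<in> sets lebesgue" by auto
  have "emeasure lebesgue (f ` S) = ennreal (measure lebesgue (f ` S))"
    using \<open>f ` S \<in> lmeasurable\<close> by (simp add: emeasure_eq_measure2)
  also have "\<dots> \<le> ennreal (integral S ?J)"
    using measure_differentiable_image[OF S f int] by (simp add: ennreal_leI)
  also have "\<dots> = (\<integral>\<^sup>+x. ennreal (?J x) \<partial>lebesgue_on S)"
    unfolding eq using \<open>integrable (lebesgue_on S) ?J\<close>
    by (subst nn_integral_eq_integral) auto
  also have "\<dots> = (\<integral>\<^sup>+x. ennreal (?J x) * indicator S x \<partial>lebesgue)"
    using S by (simp add: nn_integral_restrict_space)
  finally show "emeasure lebesgue (f ` S) \<le> (\<integral>\<^sup>+x. ennreal (?J x) * indicator S x \<partial>lebesgue)" .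
qed

text \<open>
  For one grid, adding up the inequality without multiplicities over the cells bounds the integral
  of the number of cells that hit \<open>p\<close>. Fatou's lemma then passes to the limit of ever finer grids.
\<close>
theorem area_inequality:
  fixes f :: "real^'n::{finite,wellorder} \<Rightarrow> real^'n::_"
  assumes S: "S \<in> sets lebesgue"
    and f: "\<And>x. x \<in> S \<Longrightarrow> (f has_derivative f' x) (at x within S)"
  shows "(\<integral>\<^sup>+p. emeasure (count_space UNIV) {x \<in> S. f x = p} \<partial>lebesgue)
    \<le> (\<integral>\<^sup>+x. ennreal \<bar>det (matrix (f' x))\<bar> * indicator S x \<partial>lebesgue)"
proof (cases "(\<integral>\<^sup>+x. ennreal \<bar>det (matrix (f' x))\<bar> * indicator S x \<partial>lebesgue) = \<infinity>")
  case False
  let ?J = "\<lambda>x. ennreal \<bar>det (matrix (f' x))\<bar> * indicator S x"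
  let ?Q = "\<lambda>n k. S \<inter> grid_cell n -` {k}"
  have J: "?J \<in> borel_measurable lebesgue"
    using borel_measurable_det_Jacobian[OF S f] S
    by (subst borel_measurable_restrict_space_iff_ennreal[symmetric]) auto
  have cell: "grid_cell n -` {k} \<in> sets (lebesgue :: (real^'n::{finite,wellorder}) measure)" for n k
    by (rule sets_completionI_sets) (simp add: measurable_grid_cell)
  have Q: "?Q n k \<in> sets lebesgue" for n k
    by (intro sets.Int S cell)
  have fQ: "(\<integral>\<^sup>+x. ennreal \<bar>det (matrix (f' x))\<bar> * indicator (?Q n k) x \<partial>lebesgue) < \<infinity>" for n k
  proof -
    have "(\<integral>\<^sup>+x. ennreal \<bar>det (matrix (f' x))\<bar> * indicator (?Q n k) x \<partial>lebesgue) \<le> (\<integral>\<^sup>+x. ?J x \<partial>lebesgue)"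
      by (intro nn_integral_mono) (auto simp: indicator_def)
    also have "\<dots> < \<infinity>" using False by (simp add: top.not_eq_extremum)
    finally show ?thesis .
  qed
  have derQ: "x \<in> ?Q n k \<Longrightarrow> (f has_derivative f' x) (at x within ?Q n k)" for x n k
    by (rule has_derivative_subset[OF f]) auto
  have im1[measurable]: "f ` ?Q n k \<in> sets lebesgue" for n k
    by (rule differentiable_image_lebesgue(1)[OF Q derQ fQ])
  have im2: "emeasure lebesgue (f ` ?Q n k) \<le> (\<integral>\<^sup>+x. ?J x * indicator (grid_cell n -` {k}) x \<partial>lebesgue)" for n k
    using differentiable_image_lebesgue(2)[OF Q derQ fQ, of n k]
    by (simp add: indicator_inter_arith mult.assoc)
  have N: "(\<lambda>p. \<Sum>k. indicator (f ` ?Q n k) p :: ennreal) \<in> borel_measurable lebesgue" for n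
    by measurable
  have level: "(\<integral>\<^sup>+p. (\<Sum>k. indicator (f ` ?Q n k) p) \<partial>lebesgue) \<le> (\<integral>\<^sup>+x. ?J x \<partial>lebesgue)" for n
  proof -
    have "(\<integral>\<^sup>+p. (\<Sum>k. indicator (f ` ?Q n k) p) \<partial>lebesgue) = (\<Sum>k. emeasure lebesgue (f ` ?Q n k))"
      by (subst nn_integral_suminf) (simp_all add: im1)
    also have "\<dots> \<le> (\<Sum>k. \<integral>\<^sup>+x. ?J x * indicator (grid_cell n -` {k}) x \<partial>lebesgue)"
      by (intro suminf_le im2) simp_all
    also have "\<dots> = (\<integral>\<^sup>+x. (\<Sum>k. ?J x * indicator (grid_cell n -` {k}) x) \<partial>lebesgue)"
      using J cell by (subst nn_integral_suminf) (auto intro!: borel_measurable_times_ennreal)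
    also have "\<dots> = (\<integral>\<^sup>+x. ?J x \<partial>lebesgue)"
    proof (rule nn_integral_cong)
      fix x
      have "(\<Sum>k. ?J x * indicator (grid_cell n -` {k}) x) = (\<Sum>k\<in>{grid_cell n x}. ?J x * indicator (grid_cell n -` {k}) x)"
        by (rule suminf_finite) auto
      then show "(\<Sum>k. ?J x * indicator (grid_cell n -` {k}) x) = ?J x" by simp
    qed
    finally show ?thesis .
  qed
  have "(\<integral>\<^sup>+p. emeasure (count_space UNIV) {x \<in> S. f x = p} \<partial>lebesgue)
    \<le> (\<integral>\<^sup>+p. liminf (\<lambda>n. \<Sum>k. indicator (f ` ?Q n k) p) \<partial>lebesgue)"
    by (intro nn_integral_mono count_le_liminf_grid_cells)
  also have "\<dots> \<le> liminf (\<lambda>n. \<integral>\<^sup>+p. (\<Sum>k. indicator (f ` ?Q n k) p) \<partial>lebesgue)"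
    by (rule nn_integral_liminf) (rule N)
  also have "\<dots> \<le> liminf (\<lambda>n::nat. \<integral>\<^sup>+x. ?J x \<partial>lebesgue)"
    by (rule Liminf_mono) (simp add: level)
  also have "\<dots> = (\<integral>\<^sup>+x. ?J x \<partial>lebesgue)"
    by (simp add: Liminf_const)
  finally show ?thesis .
qed simp

section \<open>Integration over three-space and the sphere\<close>

lemma vector_3_axis: "vector [a, b, c] = a *\<^sub>R axis 1 1 + b *\<^sub>R axis 2 1 + c *\<^sub>R (axis 3 1 :: real^3)"
  by (simp add: vec_eq_iff forall_3 axis_def)

lemma Basis_3: "(Basis :: (real^3) set) = {axis 1 1, axis 2 1, axis 3 1}"
  by (auto simp: Basis_vec_def UNIV_3)

lemma measurable_vector_3:
  "(\<lambda>(a, b, c). vector [a, b, c] :: real^3) \<in> borel_measurable (borel :: (real \<times> real \<times> real) measure)"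
  unfolding vector_3_axis case_prod_beta
  by (intro borel_measurable_continuous_onI continuous_intros)

lemma emeasure_lborel_Times:
  fixes A :: "'a::euclidean_space set" and B :: "'b::euclidean_space set"
  assumes "A \<in> sets borel" "B \<in> sets borel"
  shows "emeasure lborel (A \<times> B) = emeasure lborel A * emeasure lborel B"
  using assms by (simp add: lborel.emeasure_pair_measure_Times flip: lborel_prod)

lemma lborel_vec3:
  "lborel = distr (lborel :: (real \<times> real \<times> real) measure) borel (\<lambda>(a, b, c). vector [a, b, c] :: real^3)"
proof (rule lborel_eqI)
  fix l u :: "real^3"
  assume le: "\<And>b. b \<in> Basis \<Longrightarrow> l \<bullet> b \<le> u \<bullet> b"
  have le': "l $ 1 \<le> u $ 1" "l $ 2 \<le> u $ 2" "l $ 3 \<le> u $ 3"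
    using le[of "axis 1 1"] le[of "axis 2 1"] le[of "axis 3 1"] by (auto simp: Basis_3 inner_axis)
  have m: "(\<lambda>(a, b, c). vector [a, b, c] :: real^3) \<in> borel_measurable (lborel :: (real \<times> real \<times> real) measure)"
    using measurable_vector_3 by simp
  have "emeasure (distr (lborel :: (real \<times> real \<times> real) measure) borel (\<lambda>(a, b, c). vector [a, b, c])) (box l u)
      = emeasure lborel ({l $ 1<..<u $ 1} \<times> {l $ 2<..<u $ 2} \<times> {l $ 3<..<u $ 3})"
    by (subst emeasure_distr[OF m]) (auto simp: lborel_prod mem_box_cart forall_3 intro!: arg_cong[where f = "emeasure _"])
  also have "\<dots> = ennreal (\<Prod>b\<in>Basis. (u - l) \<bullet> b)"
    using le' by (simp add: emeasure_lborel_Times borel_Times Basis_3 axis_eq_axis inner_axis ennreal_mult)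
  finally show "emeasure (distr (lborel :: (real \<times> real \<times> real) measure) borel (\<lambda>(a, b, c). vector [a, b, c])) (box l u)
    = ennreal (\<Prod>b\<in>Basis. (u - l) \<bullet> b)" .
qed simp

lemma nn_integral_vec3:
  fixes f :: "real^3 \<Rightarrow> ennreal"
  assumes f: "f \<in> borel_measurable borel"
  shows "(\<integral>\<^sup>+w. f w \<partial>lborel) = (\<integral>\<^sup>+a. \<integral>\<^sup>+b. \<integral>\<^sup>+c. f (vector [a, b, c]) \<partial>lborel \<partial>lborel \<partial>lborel)"
proof -
  let ?g = "\<lambda>w :: real \<times> real \<times> real. f (vector [fst w, fst (snd w), snd (snd w)])"
  have g: "?g \<in> borel_measurable borel"
    using measurable_compose[OF measurable_vector_3 f] unfolding case_prod_beta .
  have g': "(\<lambda>w. ?g (a, w)) \<in> borel_measurable borel" for a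
    by (rule measurable_compose[OF _ g]) (intro borel_measurable_continuous_onI continuous_intros)
  have "(\<integral>\<^sup>+w. f w \<partial>lborel) = (\<integral>\<^sup>+w. ?g w \<partial>lborel)"
    by (subst lborel_vec3, subst nn_integral_distr) (use f measurable_vector_3 in \<open>auto simp: case_prod_beta\<close>)
  also have "\<dots> = (\<integral>\<^sup>+a. \<integral>\<^sup>+w. ?g (a, w) \<partial>lborel \<partial>lborel)"
    using lborel.nn_integral_fst[of ?g "lborel :: real measure"] g unfolding lborel_prod by simp
  also have "\<dots> = (\<integral>\<^sup>+a. \<integral>\<^sup>+b. \<integral>\<^sup>+c. ?g (a, b, c) \<partial>lborel \<partial>lborel \<partial>lborel)"
  proof (rule nn_integral_cong)
    fix a :: real
    show "(\<integral>\<^sup>+w. ?g (a, w) \<partial>lborel) = (\<integral>\<^sup>+b. \<integral>\<^sup>+c. ?g (a, b, c) \<partial>lborel \<partial>lborel)"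
      using lborel.nn_integral_fst[of "\<lambda>w. ?g (a, w)" "lborel :: real measure"] g'[of a] unfolding lborel_prod by simp
  qed
  finally show ?thesis by simp
qed

text \<open>
  For \<open>f\<close> that is not measurable \<open>nn_integral\<close> is a lower integral, a supremum over simple
  functions. Transport along the radial projection can therefore only increase it: simple
  functions pull back to simple functions, but the pullback may admit more of them.
\<close>
lemma nn_integral_sphere_measure_le:
  "(\<integral>\<^sup>+\<sigma>. f \<sigma> \<partial>sphere_measure) \<le> 3 * (\<integral>\<^sup>+p. f (p /\<^sub>R norm p) * indicator (ball 0 1 - {0}) p \<partial>lborel)"
  unfolding nn_integral_def[of sphere_measure]
proof (rule SUP_least, clarify)
  fix s assume s: "simple_function sphere_measure s" "s \<le> f"
  let ?B = "ball 0 1 - {0 :: real^3}"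
  let ?M = "distr (restrict_space lborel ?B) (restrict_space borel (sphere 0 1)) (\<lambda>x. x /\<^sub>R norm x)"
  have meas: "(\<lambda>x. x /\<^sub>R norm x) \<in> restrict_space lborel ?B \<rightarrow>\<^sub>M restrict_space borel (sphere 0 1)"
    by (intro measurable_restrict_space3) auto
  have sm: "s \<in> borel_measurable ?M"
    using borel_measurable_simple_function[OF s(1)] by (simp add: sphere_measure_def cong: measurable_cong_sets)
  have "integral\<^sup>S sphere_measure s = (\<integral>\<^sup>+\<sigma>. s \<sigma> \<partial>scale_measure 3 ?M)"
    using s(1) by (simp add: nn_integral_eq_simple_integral sphere_measure_def)
  also have "\<dots> = 3 * (\<integral>\<^sup>+\<sigma>. s \<sigma> \<partial>?M)"
    using sm by (simp add: nn_integral_scale_measure)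
  also have "(\<integral>\<^sup>+\<sigma>. s \<sigma> \<partial>?M) = (\<integral>\<^sup>+p. s (p /\<^sub>R norm p) \<partial>restrict_space lborel ?B)"
    using sm meas by (subst nn_integral_distr) auto
  also have "\<dots> = (\<integral>\<^sup>+p. s (p /\<^sub>R norm p) * indicator ?B p \<partial>lborel)"
    by (subst nn_integral_restrict_space) auto
  also have "\<dots> \<le> (\<integral>\<^sup>+p. f (p /\<^sub>R norm p) * indicator ?B p \<partial>lborel)"
    using s(2) by (intro nn_integral_mono mult_right_mono) (auto simp: le_fun_def)
  finally show "integral\<^sup>S sphere_measure s \<le> 3 * (\<integral>\<^sup>+p. f (p /\<^sub>R norm p) * indicator ?B p \<partial>lborel)"
    by (simp add: mult_left_mono)
qed

section \<open>The power mean inequality\<close>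

text \<open>
  Integrate Young's inequality \<open>q m powr (q - 1) y \<le> y powr q + (q - 1) m powr q\<close>, which compares
  \<open>y powr q\<close> with its tangent at the mean \<open>m = A / L\<close>.
\<close>
lemma power_mean_inequality:
  fixes g :: "'a \<Rightarrow> real"
  assumes q: "1 < q" and g: "\<And>t. 0 \<le> g t" "g \<in> borel_measurable M"
    and X: "X \<in> sets M" "emeasure M X = ennreal L" "0 < L"
    and A: "0 \<le> A" "ennreal A \<le> (\<integral>\<^sup>+t. ennreal (g t) * indicator X t \<partial>M)"
    and B: "0 \<le> B" "(\<integral>\<^sup>+t. ennreal (g t powr q) * indicator X t \<partial>M) \<le> ennreal B"
  shows "A powr q \<le> L powr (q - 1) * B"
proof (cases "A = 0")
  case False
  define m where "m = A / L"
  have m: "0 < m" using False A X by (simp add: m_def)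
  have young: "q * m powr (q - 1) * y \<le> y powr q + (q - 1) * m powr q" if "0 \<le> y" for y
  proof (cases "y = 0")
    case False
    with that have "(y powr q) powr (1 / q) * (m powr q) powr (1 - 1 / q) \<le> 1 / q * y powr q + (1 - 1 / q) * m powr q"
      using q m by (intro Youngs_inequality_0) auto
    moreover have "(m powr q) powr (1 - 1 / q) = m powr (q - 1)"
      using q by (simp add: powr_powr right_diff_distrib)
    ultimately have "q * (y * m powr (q - 1)) \<le> q * (1 / q * y powr q + (1 - 1 / q) * m powr q)"
      using q that by (simp add: powr_powr)
    moreover have "q * (1 / q * y powr q + (1 - 1 / q) * m powr q) = y powr q + (q - 1) * m powr q"
      using q by (simp add: field_simps)
    ultimately show ?thesis by (simp add: mult_ac)
  qed (use q in auto)
  have "ennreal (q * m powr (q - 1) * A) = ennreal (q * m powr (q - 1)) * ennreal A"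
    using q A by (simp add: ennreal_mult)
  also have "\<dots> \<le> ennreal (q * m powr (q - 1)) * (\<integral>\<^sup>+t. ennreal (g t) * indicator X t \<partial>M)"
    using A by (intro mult_left_mono) auto
  also have "\<dots> = (\<integral>\<^sup>+t. ennreal (q * m powr (q - 1) * g t) * indicator X t \<partial>M)"
    using g X q by (subst nn_integral_cmult[symmetric]) (auto simp: ennreal_mult mult.assoc)
  also have "\<dots> \<le> (\<integral>\<^sup>+t. ennreal (g t powr q) * indicator X t + ennreal ((q - 1) * m powr q) * indicator X t \<partial>M)"
    using young[OF g(1)] q by (intro nn_integral_mono) (auto simp: indicator_def ennreal_plus[symmetric] simp del: ennreal_plus intro!: ennreal_leI)
  also have "\<dots> = (\<integral>\<^sup>+t. ennreal (g t powr q) * indicator X t \<partial>M) + ennreal ((q - 1) * m powr q) * ennreal L"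
    using g(2) X by (subst nn_integral_add) (auto simp: nn_integral_cmult_indicator)
  also have "\<dots> \<le> ennreal B + ennreal ((q - 1) * m powr q) * ennreal L"
    using B by (intro add_right_mono)
  also have "\<dots> = ennreal (B + (q - 1) * m powr q * L)"
    using B q X by (simp add: ennreal_mult ennreal_plus)
  finally have "q * m powr (q - 1) * A \<le> B + (q - 1) * m powr q * L"
    using B q X by (subst (asm) ennreal_le_iff) auto
  moreover have AL: "A = m * L" using X by (simp add: m_def)
  have "q * m powr (q - 1) * A = q * (m powr q * L)"
    using m by (simp add: AL powr_diff)
  moreover have "(q - 1) * m powr q * L = q * (m powr q * L) - m powr q * L"
    by (simp add: algebra_simps)
  ultimately have "m powr q * L \<le> B" by linarith
  moreover have "A powr q = L powr (q - 1) * (m powr q * L)"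
    using m X by (simp add: AL powr_diff powr_mult)
  ultimately show ?thesis by (simp add: mult_left_mono)
qed (use q B in auto)

lemma emeasure_count_space_image_le:
  "emeasure (count_space UNIV) (f ` X) \<le> emeasure (count_space UNIV) X"
  by (cases "finite X") (auto simp: emeasure_count_space card_image_le)

section \<open>The integral of the majorant\<close>

lemma nn_integral_abs_powr_le:
  assumes b: "1 < b" and R: "0 \<le> R"
  shows "(\<integral>\<^sup>+z. ennreal (\<bar>z\<bar> powr (b - 2)) * indicator {-R..R} z \<partial>lborel) \<le> ennreal (2 * R powr (b - 1) / (b - 1))"
proof -
  let ?f = "\<lambda>z :: real. ennreal (z powr (b - 2)) * indicator {0..R} z"
  have [measurable]: "?f \<in> borel_measurable borel" by measurable
  have "((\<lambda>x. x powr (b - 2)) has_integral R powr (b - 2 + 1) / (b - 2 + 1)) {0..R}"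
    using b R by (intro has_integral_powr_from_0) auto
  then have half: "(\<integral>\<^sup>+z. ?f z \<partial>lborel) = ennreal (R powr (b - 1) / (b - 1))"
    by (subst nn_integral_has_integral_lebesgue') (auto simp: add.commute)
  have "(\<integral>\<^sup>+z. ennreal (\<bar>z\<bar> powr (b - 2)) * indicator {-R..R} z \<partial>lborel) \<le> (\<integral>\<^sup>+z. ?f z + ?f (0 + -1 * z) \<partial>lborel)"
    by (intro nn_integral_mono) (auto simp: indicator_def abs_if)
  also have "\<dots> = (\<integral>\<^sup>+z. ?f z \<partial>lborel) + (\<integral>\<^sup>+z. ?f (0 + -1 * z) \<partial>lborel)"
    by (intro nn_integral_add) measurable
  also have "(\<integral>\<^sup>+z. ?f (0 + -1 * z) \<partial>lborel) = (\<integral>\<^sup>+z. ?f z \<partial>lborel)"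
    using nn_integral_real_affine[of ?f "-1" 0] by simp
  finally show ?thesis
    using b R by (simp add: half flip: ennreal_plus)
qed

lemma nn_integral_square_Icc:
  assumes "0 \<le> c"
  shows "(\<integral>\<^sup>+r. ennreal (r\<^sup>2) * indicator {-c..c} r \<partial>lborel) = ennreal (2 / 3 * c ^ 3)"
proof -
  have "((\<lambda>r. r\<^sup>2) has_integral (c ^ 3 / 3 - (- c) ^ 3 / 3)) {-c..c}"
    using assms by (intro fundamental_theorem_of_calculus)
      (auto intro!: derivative_eq_intros simp: has_real_derivative_iff_has_vector_derivative[symmetric])
  then show ?thesis
    using nn_integral_has_integral_lebesgue'[of "{-c..c}" "\<lambda>r. r\<^sup>2" "c ^ 3 / 3 - (- c) ^ 3 / 3"]
    by (simp add: power3_eq_cube mult.assoc)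
qed

lemma indicator_segment_real:
  "indicator (closed_segment a b) t = (if min a b \<le> t \<and> t \<le> max a b then 1 else 0 :: ennreal)" for a b t :: real
  by (auto simp: closed_segment_eq_real_ivl)

lemma measurable_segment_integral:
  assumes [measurable]: "h \<in> borel_measurable borel" "f \<in> borel_measurable M" "g \<in> borel_measurable M"
  shows "(\<lambda>w. \<integral>\<^sup>+t. h t * indicator (closed_segment (f w) (g w)) (t::real) \<partial>lborel) \<in> borel_measurable M"
  unfolding indicator_segment_real by measurable

text \<open>
  A given \<open>t\<close> lies in the window from \<open>x\<close> to \<open>x + z\<close> for a set of \<open>x\<close> of measure \<open>\<bar>z\<bar>\<close>.
\<close>
lemma nn_integral_segment:
  fixes h :: "real \<Rightarrow> ennreal"
  assumes [measurable]: "h \<in> borel_measurable borel"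
  shows "(\<integral>\<^sup>+x. \<integral>\<^sup>+t. h t * indicator (closed_segment x (x + z)) t \<partial>lborel \<partial>lborel) = ennreal \<bar>z\<bar> * (\<integral>\<^sup>+t. h t \<partial>lborel)"
proof -
  have "(\<integral>\<^sup>+x. \<integral>\<^sup>+t. h t * indicator (closed_segment x (x + z)) t \<partial>lborel \<partial>lborel)
    = (\<integral>\<^sup>+t. \<integral>\<^sup>+x. h t * indicator (closed_segment x (x + z)) t \<partial>lborel \<partial>lborel)"
    unfolding indicator_segment_real by (rule lborel_pair.Fubini') measurable
  also have "\<dots> = (\<integral>\<^sup>+t. h t * (\<integral>\<^sup>+x. indicator (closed_segment (t - z) t) x \<partial>lborel) \<partial>lborel)"
  proof (rule nn_integral_cong)
    fix t
    have "indicator (closed_segment x (x + z)) t = (indicator (closed_segment (t - z) t) x :: ennreal)" for x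
      unfolding indicator_segment_real by (auto simp: min_def max_def)
    then show "(\<integral>\<^sup>+x. h t * indicator (closed_segment x (x + z)) t \<partial>lborel)
      = h t * (\<integral>\<^sup>+x. indicator (closed_segment (t - z) t) x \<partial>lborel)"
      by (simp add: nn_integral_cmult)
  qed
  also have "\<dots> = (\<integral>\<^sup>+t. h t * ennreal \<bar>z\<bar> \<partial>lborel)"
    by (intro nn_integral_cong) (auto simp: closed_segment_eq_real_ivl)
  also have "\<dots> = ennreal \<bar>z\<bar> * (\<integral>\<^sup>+t. h t \<partial>lborel)"
    by (subst nn_integral_multc) (auto simp: mult.commute)
  finally show ?thesis .
qed

text \<open>
  The coordinates of \<open>w\<close> are \<open>(z, x, r)\<close>. The integral over \<open>r\<close> contributes
  \<open>2 / 3 (c / \<bar>z\<bar>)\<^sup>3\<close> and the one over \<open>x\<close> contributes \<open>\<bar>z\<bar> M\<close>; hence \<open>\<bar>z\<bar> powr (b - 2)\<close> remains,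
  and \<open>1 < b\<close> is the condition for its integrability at \<open>0\<close>.
\<close>
lemma nn_integral_majorant_le:
  fixes h :: "real \<Rightarrow> ennreal"
  assumes h[measurable]: "h \<in> borel_measurable borel" and M: "(\<integral>\<^sup>+t. h t \<partial>lborel) \<le> ennreal M" "0 \<le> M"
    and b: "1 < b" and nonneg: "0 \<le> K" "0 \<le> c" "0 \<le> R"
  shows "(\<integral>\<^sup>+w. (if 0 < \<bar>w $ 1\<bar> \<and> \<bar>w $ 1\<bar> \<le> R \<and> \<bar>w $ 3\<bar> \<le> c / \<bar>w $ 1\<bar>
      then ennreal (K * (w $ 3)\<^sup>2 * \<bar>w $ 1\<bar> powr b) *
        (\<integral>\<^sup>+t. h t * indicator (closed_segment (w $ 2) (w $ 2 + w $ 1)) t \<partial>lborel)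
      else 0) \<partial>(lborel :: (real^3) measure))
    \<le> ennreal (K * (2 / 3 * c ^ 3) * M * (2 * R powr (b - 1) / (b - 1)))" (is "(\<integral>\<^sup>+w. ?f w \<partial>_) \<le> _")
proof -
  define B where "B = (\<lambda>x z. \<integral>\<^sup>+t. h t * indicator (closed_segment x (x + z)) t \<partial>lborel)"
  note [measurable] = measurable_segment_integral
  have [measurable]: "?f \<in> borel_measurable borel" by measurable
  have [measurable]: "(\<lambda>x. B x z) \<in> borel_measurable borel" for z
    unfolding B_def by measurable
  have slice: "(\<integral>\<^sup>+x. \<integral>\<^sup>+r. ?f (vector [z, x, r]) \<partial>lborel \<partial>lborel)
      \<le> ennreal (K * (2 / 3 * c ^ 3) * M) * (ennreal (\<bar>z\<bar> powr (b - 2)) * indicator {-R..R} z)" for z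
  proof (cases "0 < \<bar>z\<bar> \<and> \<bar>z\<bar> \<le> R")
    case True
    let ?a = "ennreal (K * \<bar>z\<bar> powr b) * ennreal (2 / 3 * (c / \<bar>z\<bar>) ^ 3)"
    have "(\<integral>\<^sup>+r. ?f (vector [z, x, r]) \<partial>lborel) = ?a * B x z" for x
    proof -
      have "(\<integral>\<^sup>+r. ?f (vector [z, x, r]) \<partial>lborel)
        = (\<integral>\<^sup>+r. ennreal (K * \<bar>z\<bar> powr b) * B x z * (ennreal (r\<^sup>2) * indicator {-(c / \<bar>z\<bar>)..c / \<bar>z\<bar>} r) \<partial>lborel)"
        using True nonneg by (intro nn_integral_cong)
          (auto simp: vector_3 B_def indicator_def ennreal_mult mult_ac abs_le_iff minus_le_iff)
      also have "\<dots> = ennreal (K * \<bar>z\<bar> powr b) * B x z * ennreal (2 / 3 * (c / \<bar>z\<bar>) ^ 3)"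
        using nonneg by (subst nn_integral_cmult) (auto simp: nn_integral_square_Icc)
      finally show ?thesis by (simp add: mult_ac)
    qed
    then have "(\<integral>\<^sup>+x. \<integral>\<^sup>+r. ?f (vector [z, x, r]) \<partial>lborel \<partial>lborel) = ?a * (\<integral>\<^sup>+x. B x z \<partial>lborel)"
      by (simp add: nn_integral_cmult)
    also have "\<dots> = ?a * (ennreal \<bar>z\<bar> * (\<integral>\<^sup>+t. h t \<partial>lborel))"
      unfolding B_def by (simp add: nn_integral_segment)
    also have "\<dots> \<le> ?a * (ennreal \<bar>z\<bar> * ennreal M)"
      by (intro mult_left_mono M) auto
    also have "\<dots> = ennreal (K * \<bar>z\<bar> powr b * (2 / 3 * (c / \<bar>z\<bar>) ^ 3) * (\<bar>z\<bar> * M))"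
      using nonneg M(2) by (simp add: ennreal_mult[symmetric] mult_ac)
    also have "K * \<bar>z\<bar> powr b * (2 / 3 * (c / \<bar>z\<bar>) ^ 3) * (\<bar>z\<bar> * M) = K * (2 / 3 * c ^ 3) * M * \<bar>z\<bar> powr (b - 2)"
    proof -
      have "\<bar>z\<bar> powr (b - 2) = \<bar>z\<bar> powr b / \<bar>z\<bar>\<^sup>2"
        using True by (simp add: powr_diff)
      then show ?thesis using True by (simp add: power_divide power3_eq_cube power2_eq_square)
    qed
    also have "ennreal \<dots> = ennreal (K * (2 / 3 * c ^ 3) * M) * (ennreal (\<bar>z\<bar> powr (b - 2)) * indicator {-R..R} z)"
      using True nonneg M(2) by (subst ennreal_mult) (auto simp: indicator_def)
    finally show ?thesis .
  qed (auto simp: vector_3)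
  have "(\<integral>\<^sup>+w. ?f w \<partial>lborel) = (\<integral>\<^sup>+z. \<integral>\<^sup>+x. \<integral>\<^sup>+r. ?f (vector [z, x, r]) \<partial>lborel \<partial>lborel \<partial>lborel)"
    by (rule nn_integral_vec3) measurable
  also have "\<dots> \<le> (\<integral>\<^sup>+z. ennreal (K * (2 / 3 * c ^ 3) * M) * (ennreal (\<bar>z\<bar> powr (b - 2)) * indicator {-R..R} z) \<partial>lborel)"
    by (intro nn_integral_mono slice)
  also have "\<dots> = ennreal (K * (2 / 3 * c ^ 3) * M) * (\<integral>\<^sup>+z. ennreal (\<bar>z\<bar> powr (b - 2)) * indicator {-R..R} z \<partial>lborel)"
    by (rule nn_integral_cmult) measurable
  also have "\<dots> \<le> ennreal (K * (2 / 3 * c ^ 3) * M) * ennreal (2 * R powr (b - 1) / (b - 1))"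
    using b nonneg by (intro mult_left_mono nn_integral_abs_powr_le) auto
  also have "\<dots> = ennreal (K * (2 / 3 * c ^ 3) * M * (2 * R powr (b - 1) / (b - 1)))"
    using b nonneg M(2) by (subst ennreal_mult) auto
  finally show ?thesis .
qed

section \<open>The secant map and its Jacobian\<close>

text \<open>
  The coordinates are \<open>w = (z, x, r)\<close>: parameter difference, base point, and radial scale. The
  scale may be negative, so that a chord covers both directions \<open>\<sigma>\<close> and \<open>-\<sigma>\<close>.
\<close>
definition secant_map :: "(real \<Rightarrow> real^3) \<Rightarrow> real^3 \<Rightarrow> real^3" where
  "secant_map \<gamma> w = w $ 3 *\<^sub>R (\<gamma> (w $ 2 + w $ 1) - \<gamma> (w $ 2))"

definition secant_deriv :: "(real \<Rightarrow> real^3) \<Rightarrow> real^3 \<Rightarrow> real^3 \<Rightarrow> real^3" where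
  "secant_deriv \<gamma> w h =
     h $ 3 *\<^sub>R (\<gamma> (w $ 2 + w $ 1) - \<gamma> (w $ 2)) +
     w $ 3 *\<^sub>R ((h $ 2 + h $ 1) *\<^sub>R velocity \<gamma> (w $ 2 + w $ 1) - h $ 2 *\<^sub>R velocity \<gamma> (w $ 2))"

lemma has_vector_derivative_velocity:
  "\<gamma> differentiable (at x) \<Longrightarrow> (\<gamma> has_vector_derivative velocity \<gamma> x) (at x)"
  by (simp add: velocity_def vector_derivative_works)

lemma has_derivative_secant_map:
  assumes "\<And>x. \<gamma> differentiable (at x)"
  shows "(secant_map \<gamma> has_derivative secant_deriv \<gamma> w) (at w within S)"
proof -
  have \<gamma>: "(\<gamma> has_derivative (\<lambda>h. h *\<^sub>R velocity \<gamma> x)) (at x)" for x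
    using has_vector_derivative_velocity[OF assms] by (simp add: has_vector_derivative_def)
  have [derivative_intros]: "((\<lambda>w. w $ i) has_derivative (\<lambda>h. h $ i)) (at w within S)" for i and w :: "real^3"
    by (rule bounded_linear_imp_has_derivative) (rule bounded_linear_vec_nth)
  have 1: "((\<lambda>w. \<gamma> (w $ 2 + w $ 1)) has_derivative (\<lambda>h. (h $ 2 + h $ 1) *\<^sub>R velocity \<gamma> (w $ 2 + w $ 1))) (at w within S)"
    by (rule has_derivative_compose[OF _ \<gamma>]) (auto intro!: derivative_intros)
  have 2: "((\<lambda>w. \<gamma> (w $ 2)) has_derivative (\<lambda>h. h $ 2 *\<^sub>R velocity \<gamma> (w $ 2))) (at w within S)"
    by (rule has_derivative_compose[OF _ \<gamma>]) (auto intro!: derivative_intros)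
  show ?thesis
    unfolding secant_map_def[abs_def] secant_deriv_def[abs_def]
    by (auto intro!: derivative_eq_intros 1 2)
qed

lemma det_secant_deriv:
  "\<bar>det (matrix (secant_deriv \<gamma> w))\<bar> =
     (w $ 3)\<^sup>2 * \<bar>(\<gamma> (w $ 2 + w $ 1) - \<gamma> (w $ 2)) \<bullet> (cross3 (velocity \<gamma> (w $ 2 + w $ 1)) (velocity \<gamma> (w $ 2)))\<bar>"
proof -
  have "det (matrix (\<lambda>h. h $ 3 *\<^sub>R d + r *\<^sub>R ((h $ 2 + h $ 1) *\<^sub>R b - h $ 2 *\<^sub>R a)))
      = - (r\<^sup>2 * (d \<bullet> (cross3 b a)))" for a b d :: "real^3" and r :: real
    by (simp add: det_3 matrix_def axis_def cross3_def inner_vec_def sum_3 vector_3 power2_eq_square) algebra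
  from this[of "\<gamma> (w $ 2 + w $ 1) - \<gamma> (w $ 2)"] show ?thesis
    by (simp add: secant_deriv_def[abs_def] abs_mult)
qed

lemma norm_cross_le: "norm (cross3 a b) \<le> norm a * norm b"
proof (rule power2_le_imp_le)
  show "(norm (cross3 a b))\<^sup>2 \<le> (norm a * norm b)\<^sup>2"
    by (simp add: norm_cross power_mult_distrib)
qed simp

lemma triple_product_shift:
  "d \<bullet> (cross3 b a) = (d - c *\<^sub>R b) \<bullet> (cross3 b (a - b))" for a b d :: "real^3"
  by (simp add: cross3_def inner_vec_def sum_3 vector_3 algebra_simps)

text \<open>
  Column operations replace the chord by its deviation from the tangent at \<open>y\<close> and one velocity by
  the difference of the two. The first is at most \<open>\<bar>y - x\<bar> A\<close> by the mean value inequality and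
  the second at most \<open>A\<close>.
\<close>
lemma triple_product_secant_le:
  fixes \<gamma> :: "real \<Rightarrow> real^3"
  assumes diff: "\<And>t. \<gamma> differentiable (at t)"
    and osc: "\<And>t. t \<in> closed_segment x y \<Longrightarrow> norm (velocity \<gamma> t - velocity \<gamma> y) \<le> A"
  shows "\<bar>(\<gamma> y - \<gamma> x) \<bullet> (cross3 (velocity \<gamma> y) (velocity \<gamma> x))\<bar> \<le> \<bar>y - x\<bar> * A\<^sup>2 * norm (velocity \<gamma> y)"
proof -
  let ?u = "\<gamma> y - \<gamma> x - (y - x) *\<^sub>R velocity \<gamma> y" and ?dv = "velocity \<gamma> x - velocity \<gamma> y"
  have A: "0 \<le> A" using order_trans[OF norm_ge_zero osc[of x]] by simp
  have u: "norm ?u \<le> norm (y - x) * A"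
    by (rule vector_differentiable_bound_linearization[of "closed_segment x y"])
      (auto intro: osc has_vector_derivative_at_within has_vector_derivative_velocity diff)
  have dv: "norm ?dv \<le> A" by (rule osc) simp
  have "(\<gamma> y - \<gamma> x) \<bullet> (cross3 (velocity \<gamma> y) (velocity \<gamma> x)) = ?u \<bullet> (cross3 (velocity \<gamma> y) ?dv)"
    by (rule triple_product_shift)
  also have "\<bar>\<dots>\<bar> \<le> norm ?u * (norm (velocity \<gamma> y) * norm ?dv)"
    by (rule order_trans[OF Cauchy_Schwarz_ineq2]) (intro mult_left_mono norm_cross_le norm_ge_zero)
  also have "\<dots> \<le> (\<bar>y - x\<bar> * A) * (norm (velocity \<gamma> y) * A)"
    using u dv A by (intro mult_mono) auto
  finally show ?thesis by (simp add: power2_eq_square mult_ac)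
qed

text \<open>
  If the chord \<open>D\<close> is parallel to \<open>p\<close>, say \<open>D = m p\<close>, then \<open>r = 1 / m\<close> solves \<open>r D = p\<close>, and
  \<open>\<bar>p\<bar> < 1\<close> bounds \<open>\<bar>r\<bar>\<close> by \<open>1 / \<bar>D\<bar>\<close>, which the lower bound on chords turns into \<open>c / \<bar>z\<bar>\<close>.
\<close>
lemma emeasure_crossings_le:
  assumes p: "p \<in> ball 0 1 - {0}"
    and chord: "\<And>x z. x \<in> circle \<Longrightarrow> z \<in> circle \<Longrightarrow> z \<noteq> 0 \<Longrightarrow> \<bar>z\<bar> \<le> c * norm (\<gamma> (x + z) - \<gamma> x)"
  shows "emeasure (count_space UNIV) (crossings \<gamma> (p /\<^sub>R norm p))
    \<le> emeasure (count_space UNIV)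
        {w \<in> {w. w $ 1 \<in> circle - {0} \<and> w $ 2 \<in> circle \<and> \<bar>w $ 3\<bar> \<le> c / \<bar>w $ 1\<bar>}. secant_map \<gamma> w = p}"
    (is "_ \<le> emeasure _ ?W")
proof -
  have "crossings \<gamma> (p /\<^sub>R norm p) \<subseteq> (\<lambda>w :: real^3. (w $ 2, w $ 1)) ` ?W"
  proof
    fix xz assume "xz \<in> crossings \<gamma> (p /\<^sub>R norm p)"
    then obtain x z where xz: "xz = (x, z)" "x \<in> circle" "z \<in> circle" "z \<noteq> 0"
      and eq: "proj_perp (p /\<^sub>R norm p) (\<gamma> x) = proj_perp (p /\<^sub>R norm p) (\<gamma> (x + z))"
      unfolding crossings_def by blast
    define D where "D = \<gamma> (x + z) - \<gamma> x"
    define \<sigma> where "\<sigma> = p /\<^sub>R norm p"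
    define m where "m = (D \<bullet> \<sigma>) / norm p"
    have z: "\<bar>z\<bar> \<le> c * norm D" using chord[of x z] xz by (simp add: D_def)
    have "\<gamma> x - (\<gamma> x \<bullet> \<sigma>) *\<^sub>R \<sigma> = \<gamma> (x + z) - (\<gamma> (x + z) \<bullet> \<sigma>) *\<^sub>R \<sigma>"
      using eq by (simp only: proj_perp_def \<sigma>_def)
    then have "D = (D \<bullet> \<sigma>) *\<^sub>R \<sigma>"
      unfolding D_def inner_diff_left scaleR_left_diff_distrib by (simp add: algebra_simps)
    then have D: "D = m *\<^sub>R p"
      by (simp add: m_def \<sigma>_def divide_inverse)
    have "D \<noteq> 0" using z xz by auto
    then have m: "m \<noteq> 0" using D by auto
    have "norm D = \<bar>m\<bar> * norm p" using D by simp
    then have nD: "norm D \<le> \<bar>m\<bar>" using p mult_left_le[of "norm p" "\<bar>m\<bar>"] by simp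
    have "0 < c * norm D" using z xz(4) by linarith
    then have c: "0 < c" using norm_ge_zero[of D] by (simp add: zero_less_mult_iff)
    have "c * norm D \<le> c * \<bar>m\<bar>" using nD c by (intro mult_left_mono) auto
    with z have "\<bar>z\<bar> \<le> c * \<bar>m\<bar>" by linarith
    then have "\<bar>z\<bar> / \<bar>m\<bar> \<le> c"
      using m by (simp add: pos_divide_le_eq)
    then have r: "\<bar>1 / m\<bar> \<le> c / \<bar>z\<bar>"
      using xz by (simp add: pos_le_divide_eq abs_divide)
    have "secant_map \<gamma> (vector [z, x, 1 / m]) = p"
      using m unfolding secant_map_def vector_3 D_def[symmetric] D by simp
    then have "vector [z, x, 1 / m] \<in> ?W"
      using xz(2-) r by (simp add: vector_3)
    moreover have "xz = (\<lambda>w :: real^3. (w $ 2, w $ 1)) (vector [z, x, 1 / m])"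
      by (simp add: xz(1) vector_3)
    ultimately show "xz \<in> (\<lambda>w :: real^3. (w $ 2, w $ 1)) ` ?W"
      by (rule image_eqI[rotated])
  qed
  then have "emeasure (count_space UNIV) (crossings \<gamma> (p /\<^sub>R norm p)) \<le> emeasure (count_space UNIV) ((\<lambda>w :: real^3. (w $ 2, w $ 1)) ` ?W)"
    by (intro emeasure_mono) auto
  also have "\<dots> \<le> emeasure (count_space UNIV) ?W"
    by (rule emeasure_count_space_image_le)
  finally show ?thesis .
qed

section \<open>Periodicity\<close>

lemma has_vector_derivative_periodic:
  assumes per: "\<And>t. f (t + p) = f t" and D: "(f has_vector_derivative D) (at (x + p))"
  shows "(f has_vector_derivative D) (at x)"
proof -
  have "((f \<circ> (\<lambda>t. t + p)) has_vector_derivative 1 *\<^sub>R D) (at x)"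
    by (rule vector_diff_chain_at) (auto intro!: derivative_eq_intros D)
  then show ?thesis using per by (simp add: o_def)
qed

lemma vector_derivative_periodic:
  assumes per: "\<And>t. f (t + p) = f t"
  shows "vector_derivative f (at (x + p)) = vector_derivative f (at x)"
proof -
  have "f (t - p) = f t" for t using per[of "t - p"] by simp
  then have "(f has_vector_derivative D) (at (x + p)) \<longleftrightarrow> (f has_vector_derivative D) (at x)" for D
    using has_vector_derivative_periodic[of f p D x] has_vector_derivative_periodic[of f "- p" D "x + p"] per by auto
  then show ?thesis by (simp add: vector_derivative_def)
qed

text \<open>
  Arcs that start in the fundamental domain \<open>{-pi..<pi}\<close> may leave it, but they remain within
  this period and the two adjacent ones.
\<close>
lemma has_integral_three_periods:
  fixes f :: "real \<Rightarrow> real"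
  assumes per: "\<And>t. f (t + 2 * p) = f t" and p: "0 \<le> p" and f: "(f has_integral I) {-p..p}"
  shows "(f has_integral 3 * I) {-3 * p..3 * p}"
proof -
  have per': "f (t - 2 * p) = f t" for t using per[of "t - 2 * p"] by simp
  have "(f has_integral I) {-3 * p..-p}"
    using has_integral_affinity'[of f I "-p" p 1 "2 * p"] f by (simp add: per)
  moreover have "(f has_integral I) {p..3 * p}"
    using has_integral_affinity'[of f I "-p" p 1 "- 2 * p"] f by (simp add: per')
  ultimately have "(f has_integral I + I + I) {-3 * p..3 * p}"
    using p f by (intro has_integral_combine[of _ p] has_integral_combine[of _ "-p"]) auto
  then show ?thesis by simp
qed

section \<open>Curves of constant speed\<close>

lemma speed_pos: "closed_constant_speed_curve \<gamma> \<Longrightarrow> 0 < len \<gamma> / (2 * pi)"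
  by (simp add: closed_constant_speed_curve_def)

lemma arc_distance_constant_speed:
  assumes "closed_constant_speed_curve \<gamma>"
  shows "arc_distance \<gamma> x y = len \<gamma> / (2 * pi) * min \<bar>x - y\<bar> (2 * pi - \<bar>x - y\<bar>)"
proof -
  let ?v = "len \<gamma> / (2 * pi)"
  have "(LINT t:{min x y..max x y}|lebesgue. norm (velocity \<gamma> t)) = ?v * \<bar>x - y\<bar>"
    using assms by (simp add: closed_constant_speed_curve_def set_lebesgue_integral_def min_def max_def)
  then have "arc_distance \<gamma> x y = min (?v * \<bar>x - y\<bar>) (?v * (2 * pi - \<bar>x - y\<bar>))"
    by (simp add: arc_distance_def Let_def right_diff_distrib)
  then show ?thesis
    using speed_pos[OF assms] by (simp add: min_mult_distrib_left)
qed

text \<open>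
  The distortion is a supremum over parameters in the fundamental domain, so \<open>x + z\<close> has to be
  moved back by a period if it lies outside; as \<open>\<bar>z\<bar> \<le> pi\<close>, the shorter arc from \<open>x\<close> to the new
  parameter still has parameter length \<open>\<bar>z\<bar>\<close>.
\<close>
lemma chord_lower_bound:
  assumes \<gamma>: "closed_constant_speed_curve \<gamma>" and fin: "distortion \<gamma> < \<infinity>"
    and x: "x \<in> circle" and z: "z \<in> circle" "z \<noteq> 0"
  shows "len \<gamma> / (2 * pi) * \<bar>z\<bar> \<le> enn2real (distortion \<gamma>) * norm (\<gamma> (x + z) - \<gamma> x)"
proof -
  let ?v = "len \<gamma> / (2 * pi)"
  have per: "\<gamma> (t + 2 * pi) = \<gamma> t" for t
    using \<gamma> by (simp add: closed_constant_speed_curve_def)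
  obtain y where y: "y \<in> circle" "y \<noteq> x" "\<gamma> y = \<gamma> (x + z)" "\<bar>x - y\<bar> = \<bar>z\<bar> \<or> \<bar>x - y\<bar> = 2 * pi - \<bar>z\<bar>"
  proof -
    consider "x + z \<in> circle" | "x + z < -pi" | "pi \<le> x + z" by fastforce
    then show thesis
    proof cases
      case 1
      then show ?thesis using z by (intro that[of "x + z"]) auto
    next
      case 2
      then show ?thesis using x z per[of "x + z"] by (intro that[of "x + z + 2 * pi"]) auto
    next
      case 3
      then show ?thesis using x z per[of "x + z - 2 * pi"] by (intro that[of "x + z - 2 * pi"]) auto
    qed
  qed
  have "min \<bar>x - y\<bar> (2 * pi - \<bar>x - y\<bar>) = \<bar>z\<bar>"
    using y(4) z by (auto simp: min_def)
  then have arc: "arc_distance \<gamma> x y = ?v * \<bar>z\<bar>"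
    by (simp add: arc_distance_constant_speed[OF \<gamma>])
  have "ennreal (arc_distance \<gamma> x y) / ennreal (dist (\<gamma> x) (\<gamma> y)) \<le> distortion \<gamma>"
    unfolding distortion_def using x y(1,2) by (intro SUP_upper2[of "(x, y)"]) auto
  then have le: "ennreal (?v * \<bar>z\<bar>) / ennreal (norm (\<gamma> (x + z) - \<gamma> x)) \<le> distortion \<gamma>"
    by (simp add: arc y(3) dist_norm norm_minus_commute)
  have pos: "0 < ?v * \<bar>z\<bar>" by (intro mult_pos_pos speed_pos[OF \<gamma>]) (simp add: z)
  show ?thesis
  proof (cases "\<gamma> (x + z) = \<gamma> x")
    case True
    have "ennreal (?v * \<bar>z\<bar>) \<noteq> 0" using pos unfolding ennreal_eq_0_iff by (simp only: not_le)
    then show ?thesis using True le fin by (simp add: top_unique)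
  next
    case False
    then have "ennreal (?v * \<bar>z\<bar> / norm (\<gamma> (x + z) - \<gamma> x)) \<le> ennreal (enn2real (distortion \<gamma>))"
      using le pos fin by (simp add: divide_ennreal)
    then have "?v * \<bar>z\<bar> / norm (\<gamma> (x + z) - \<gamma> x) \<le> enn2real (distortion \<gamma>)"
      by (simp add: ennreal_le_iff)
    moreover have "0 < norm (\<gamma> (x + z) - \<gamma> x)" using False by simp
    ultimately show ?thesis by (simp only: pos_divide_le_eq)
  qed
qed

lemma velocity_oscillation:
  assumes tc: "finite_total_curvature q \<gamma>" and st: "s \<in> {a..b}" "t \<in> {a..b}"
  shows "ennreal (norm (velocity \<gamma> t - velocity \<gamma> s))
    \<le> (\<integral>\<^sup>+u. ennreal (norm (acceleration \<gamma> u)) * indicator {a..b} u \<partial>lebesgue)"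
  using st
proof (induction s t rule: linorder_wlog)
  case (le s t)
  have int: "set_integrable lebesgue {s..t} (acceleration \<gamma>)"
    and eq: "velocity \<gamma> t - velocity \<gamma> s = (LINT u:{s..t}|lebesgue. acceleration \<gamma> u)"
    using tc le by (auto simp: finite_total_curvature_def)
  have "ennreal (norm (velocity \<gamma> t - velocity \<gamma> s)) \<le> (\<integral>\<^sup>+u. norm (indicator {s..t} u *\<^sub>R acceleration \<gamma> u) \<partial>lebesgue)"
    unfolding eq set_lebesgue_integral_def
    using int by (intro integral_norm_bound_ennreal) (simp add: set_integrable_def)
  also have "\<dots> \<le> (\<integral>\<^sup>+u. ennreal (norm (acceleration \<gamma> u)) * indicator {a..b} u \<partial>lebesgue)"
    using le by (intro nn_integral_mono) (auto simp: indicator_def)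
  finally show ?case .
qed (simp add: norm_minus_commute)

text \<open>
  Only the factor \<open>B powr (2 / q - 1)\<close> of \<open>B powr (2 / q)\<close> is estimated by the global bound \<open>M\<close>; one
  factor \<open>B\<close> is kept. This is where \<open>q \<le> 2\<close> is used.
\<close>
lemma square_le_of_power_mean:
  fixes A B L M q :: real
  assumes q: "0 < q" "q \<le> 2" and nonneg: "0 \<le> A" "0 \<le> B" "0 < L" and le: "A powr q \<le> L powr (q - 1) * B" "B \<le> M"
  shows "A\<^sup>2 \<le> L powr (2 - 2 / q) * (M powr (2 / q - 1) * B)"
proof (cases "A = 0")
  case False
  have "A\<^sup>2 = (A powr q) powr (2 / q)"
    using False nonneg q by (simp add: powr_powr)
  also have "\<dots> \<le> (L powr (q - 1) * B) powr (2 / q)"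
    using q le by (intro powr_mono2) auto
  also have "\<dots> = L powr (2 - 2 / q) * B powr (2 / q)"
    using nonneg q by (simp add: powr_mult powr_powr field_simps)
  also have "B powr (2 / q) = B powr (2 / q - 1) * B"
    using nonneg by (cases "B = 0") (simp_all add: powr_diff)
  also have "\<dots> \<le> M powr (2 / q - 1) * B"
    using q nonneg le by (intro mult_right_mono powr_mono2) (auto simp: field_simps)
  finally show ?thesis by (simp add: mult_left_mono)
qed (use nonneg in auto)

lemma jacobian_secant_le:
  assumes q: "1 < q" "q \<le> 2" and \<gamma>: "closed_constant_speed_curve \<gamma>" and tc: "finite_total_curvature q \<gamma>"
    and z: "w $ 1 \<noteq> 0"
    and M: "(\<integral>\<^sup>+t. ennreal (norm (acceleration \<gamma> t) powr q) * indicator (closed_segment (w $ 2) (w $ 2 + w $ 1)) t \<partial>lebesgue) \<le> ennreal M"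
      "0 \<le> M"
  shows "ennreal \<bar>det (matrix (secant_deriv \<gamma> w))\<bar>
    \<le> ennreal (len \<gamma> / (2 * pi) * M powr (2 / q - 1) * (w $ 3)\<^sup>2 * \<bar>w $ 1\<bar> powr (3 - 2 / q)) *
      (\<integral>\<^sup>+t. ennreal (norm (acceleration \<gamma> t) powr q) * indicator (closed_segment (w $ 2) (w $ 2 + w $ 1)) t \<partial>lebesgue)"
    (is "_ \<le> _ * ?B")
proof -
  let ?v = "len \<gamma> / (2 * pi)"
  define x z y where "x = w $ 2" and "z = w $ 1" and "y = x + z"
  have z0: "z \<noteq> 0" using z by (simp add: z_def)
  define a b where "a = min x y" and "b = max x y"
  have seg: "closed_segment x y = {a..b}" and ab: "a \<le> b" "b - a = \<bar>z\<bar>"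
    by (auto simp: closed_segment_eq_real_ivl a_def b_def y_def)
  let ?I = "\<integral>\<^sup>+u. ennreal (norm (acceleration \<gamma> u)) * indicator {a..b} u \<partial>lebesgue"
  have int: "set_integrable lebesgue {a..b} (acceleration \<gamma>)"
    using tc ab by (auto simp: finite_total_curvature_def)
  have I: "?I = (\<integral>\<^sup>+u. norm (indicator {a..b} u *\<^sub>R acceleration \<gamma> u) \<partial>lebesgue)"
    by (intro nn_integral_cong) (auto simp: indicator_def)
  have finI: "?I < \<infinity>"
    unfolding I using int by (simp add: set_integrable_def integrable_iff_bounded)
  define A B where "A = enn2real ?I" and "B = enn2real ?B"
  have A: "ennreal A = ?I" "0 \<le> A" using finI by (auto simp: A_def)
  have B: "ennreal B = ?B" "0 \<le> B" "B \<le> M"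
  proof -
    show "ennreal B = ?B" using M(1) by (simp add: B_def top_unique less_top le_less_trans)
    then show "B \<le> M" using M by (metis ennreal_le_iff)
  qed (simp add: B_def)
  have "A powr q \<le> \<bar>z\<bar> powr (q - 1) * B"
  proof (rule power_mean_inequality[where M = lebesgue and X = "{a..b}" and g = "\<lambda>u. norm (indicator {a..b} u *\<^sub>R acceleration \<gamma> u)"])
    show "(\<lambda>u. norm (indicator {a..b} u *\<^sub>R acceleration \<gamma> u)) \<in> borel_measurable lebesgue"
      using int unfolding set_integrable_def by (rule measurable_compose[OF borel_measurable_integrable borel_measurable_norm])
    show "ennreal A \<le> (\<integral>\<^sup>+u. ennreal (norm (indicator {a..b} u *\<^sub>R acceleration \<gamma> u)) * indicator {a..b} u \<partial>lebesgue)"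
      unfolding A by (intro nn_integral_mono) (auto simp: indicator_def)
    show "(\<integral>\<^sup>+u. ennreal (norm (indicator {a..b} u *\<^sub>R acceleration \<gamma> u) powr q) * indicator {a..b} u \<partial>lebesgue) \<le> ennreal B"
      unfolding B x_def[symmetric] z_def[symmetric] y_def[symmetric] seg
      by (intro nn_integral_mono) (auto simp: indicator_def)
  qed (use q A B ab z0 in auto)
  then have A2: "A\<^sup>2 \<le> \<bar>z\<bar> powr (2 - 2 / q) * (M powr (2 / q - 1) * B)"
    using q A B z0 by (intro square_le_of_power_mean) auto
  have "norm (velocity \<gamma> t - velocity \<gamma> y) \<le> A" if "t \<in> closed_segment x y" for t
  proof -
    have "ennreal (norm (velocity \<gamma> t - velocity \<gamma> y)) \<le> ennreal A"
      unfolding A(1) using that by (intro velocity_oscillation[OF tc]) (auto simp: seg[symmetric])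
    then show ?thesis using A(2) by simp
  qed
  then have "\<bar>(\<gamma> y - \<gamma> x) \<bullet> (cross3 (velocity \<gamma> y) (velocity \<gamma> x))\<bar> \<le> \<bar>y - x\<bar> * A\<^sup>2 * norm (velocity \<gamma> y)"
    using \<gamma> by (intro triple_product_secant_le) (auto simp: closed_constant_speed_curve_def)
  also have "\<dots> = \<bar>z\<bar> * A\<^sup>2 * ?v"
    using \<gamma> by (simp add: closed_constant_speed_curve_def y_def)
  also have "\<dots> \<le> \<bar>z\<bar> * (\<bar>z\<bar> powr (2 - 2 / q) * (M powr (2 / q - 1) * B)) * ?v"
    using A2 speed_pos[OF \<gamma>] by (intro mult_right_mono mult_left_mono) auto
  also have "\<dots> = ?v * M powr (2 / q - 1) * \<bar>z\<bar> powr (3 - 2 / q) * B"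
  proof -
    have "\<bar>z\<bar> powr (3 - 2 / q) = \<bar>z\<bar> powr (1 + (2 - 2 / q))" by simp
    also have "\<dots> = \<bar>z\<bar> * \<bar>z\<bar> powr (2 - 2 / q)"
      using z0 by (simp only: powr_add) simp
    finally show ?thesis by simp
  qed
  finally have "(w $ 3)\<^sup>2 * \<bar>(\<gamma> y - \<gamma> x) \<bullet> (cross3 (velocity \<gamma> y) (velocity \<gamma> x))\<bar>
      \<le> (w $ 3)\<^sup>2 * (?v * M powr (2 / q - 1) * \<bar>z\<bar> powr (3 - 2 / q) * B)"
    by (rule mult_left_mono) simp
  then have "\<bar>det (matrix (secant_deriv \<gamma> w))\<bar> \<le> ?v * M powr (2 / q - 1) * (w $ 3)\<^sup>2 * \<bar>z\<bar> powr (3 - 2 / q) * B"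
    unfolding det_secant_deriv x_def[symmetric] z_def[symmetric] y_def[symmetric] by (simp add: mult_ac)
  then have "ennreal \<bar>det (matrix (secant_deriv \<gamma> w))\<bar> \<le> ennreal (?v * M powr (2 / q - 1) * (w $ 3)\<^sup>2 * \<bar>z\<bar> powr (3 - 2 / q) * B)"
    by (rule ennreal_leI)
  also have "\<dots> = ennreal (?v * M powr (2 / q - 1) * (w $ 3)\<^sup>2 * \<bar>z\<bar> powr (3 - 2 / q)) * ennreal B"
    by (intro ennreal_mult mult_nonneg_nonneg powr_ge_zero zero_le_power2 B(2) less_imp_le[OF speed_pos[OF \<gamma>]])
  finally show ?thesis unfolding B z_def .
qed

section \<open>Total curvature in terms of the acceleration\<close>

lemma acceleration_periodic:
  assumes "closed_constant_speed_curve \<gamma>"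
  shows "acceleration \<gamma> (t + 2 * pi) = acceleration \<gamma> t"
proof -
  have "velocity \<gamma> (t + 2 * pi) = velocity \<gamma> t" for t
    unfolding velocity_def using assms
    by (intro vector_derivative_periodic) (simp add: closed_constant_speed_curve_def)
  then show ?thesis
    unfolding acceleration_def by (intro vector_derivative_periodic)
qed

lemma curvature_powr_speed:
  assumes \<gamma>: "closed_constant_speed_curve \<gamma>"
  shows "curvature \<gamma> x powr q * norm (velocity \<gamma> x) = (len \<gamma> / (2 * pi)) powr (1 - 2 * q) * norm (acceleration \<gamma> x) powr q"
proof -
  define v where "v = len \<gamma> / (2 * pi)"
  have v: "0 < v" unfolding v_def by (rule speed_pos[OF \<gamma>])
  have "curvature \<gamma> x = norm (acceleration \<gamma> x) / v\<^sup>2"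
    by (simp add: curvature_def v_def power_divide power_mult_distrib field_simps)
  also have "v\<^sup>2 = v powr 2" using v by simp
  finally have "curvature \<gamma> x powr q = (norm (acceleration \<gamma> x) / v powr 2) powr q"
    by (rule arg_cong)
  also have "\<dots> = norm (acceleration \<gamma> x) powr q / v powr (2 * q)"
    by (subst powr_divide) (use v in \<open>auto simp only: powr_powr norm_ge_zero powr_ge_zero\<close>)
  finally have "curvature \<gamma> x powr q = norm (acceleration \<gamma> x) powr q / v powr (2 * q)" .
  moreover have "norm (velocity \<gamma> x) = v"
    using \<gamma> by (simp add: closed_constant_speed_curve_def v_def)
  moreover have "v powr (1 - 2 * q) = v / v powr (2 * q)"
    using v by (simp add: powr_diff)
  ultimately show ?thesis unfolding v_def[symmetric] by simp
qed

lemma total_curvature_sq: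
  assumes \<gamma>: "closed_constant_speed_curve \<gamma>" and q: "0 < q"
  defines "N \<equiv> LINT x:circle|lebesgue. norm (acceleration \<gamma> x) powr q"
  shows "(total_curvature q \<gamma>)\<^sup>2 = (N / (2 * pi)) powr (2 / q) / (len \<gamma> / (2 * pi))\<^sup>2"
proof -
  let ?v = "len \<gamma> / (2 * pi)"
  have v: "0 < ?v" by (rule speed_pos[OF \<gamma>])
  have N: "0 \<le> N" unfolding N_def set_lebesgue_integral_def by (intro Bochner_Integration.integral_nonneg) auto
  have "total_curvature q \<gamma> = ?v powr (1 - 1 / q) * (1 / (2 * pi) * (?v powr (1 - 2 * q) * N)) powr (1 / q)"
    by (simp add: total_curvature_def curvature_powr_speed[OF \<gamma>] N_def)
  also have "1 / (2 * pi) * (?v powr (1 - 2 * q) * N) = ?v powr (1 - 2 * q) * (N / (2 * pi))"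
    by simp
  also have "(?v powr (1 - 2 * q) * (N / (2 * pi))) powr (1 / q) = ?v powr ((1 - 2 * q) / q) * (N / (2 * pi)) powr (1 / q)"
    using N v by (subst powr_mult) (auto simp: powr_powr)
  also have "?v powr (1 - 1 / q) * (?v powr ((1 - 2 * q) / q) * (N / (2 * pi)) powr (1 / q))
    = ?v powr (1 - 1 / q + (1 - 2 * q) / q) * (N / (2 * pi)) powr (1 / q)"
    by (simp only: powr_add mult.assoc)
  also have "1 - 1 / q + (1 - 2 * q) / q = -1" using q by (simp add: field_simps)
  also have "?v powr -1 = 1 / ?v" using v by (subst powr_minus) (simp add: field_simps)
  finally have "total_curvature q \<gamma> = (N / (2 * pi)) powr (1 / q) / ?v" by simp
  moreover have "((N / (2 * pi)) powr (1 / q))\<^sup>2 = (N / (2 * pi)) powr (2 / q)"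
    by (simp add: power2_eq_square flip: powr_add)
  ultimately show ?thesis by (simp only: power_divide)
qed

lemma nn_integral_acceleration:
  assumes \<gamma>: "closed_constant_speed_curve \<gamma>" and tc: "finite_total_curvature q \<gamma>"
  defines "N \<equiv> LINT x:circle|lebesgue. norm (acceleration \<gamma> x) powr q"
  shows "(\<integral>\<^sup>+t. ennreal (norm (acceleration \<gamma> t) powr q) * indicator {-3 * pi..3 * pi} t \<partial>lborel) = ennreal (3 * N)"
    and "(\<lambda>t. ennreal (norm (acceleration \<gamma> t) powr q) * indicator {-3 * pi..3 * pi} t) \<in> borel_measurable lebesgue"
proof -
  let ?v = "len \<gamma> / (2 * pi)" and ?F = "\<lambda>t. norm (acceleration \<gamma> t) powr q"
  have v: "0 < ?v" by (rule speed_pos[OF \<gamma>])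
  have "set_integrable lebesgue circle (\<lambda>x. ?v powr (1 - 2 * q) * ?F x)"
    using tc by (simp add: finite_total_curvature_def curvature_powr_speed[OF \<gamma>])
  then have "set_integrable lebesgue circle ?F"
    using v by (subst (asm) set_integrable_mult_right_iff) auto
  then have "(?F has_integral N) circle"
    unfolding N_def by (rule has_integral_set_lebesgue)
  then have "(?F has_integral N) {-pi..pi}"
  proof (rule has_integral_spike_set_eq[THEN iffD1, rotated 2])
    show "negligible {x \<in> circle - {-pi..pi}. ?F x \<noteq> 0}"
      by (rule negligible_subset[of "{}"]) auto
    show "negligible {x \<in> {-pi..pi} - circle. ?F x \<noteq> 0}"
      by (rule negligible_subset[of "{pi}"]) auto
  qed
  then have int: "(?F has_integral 3 * N) {-3 * pi..3 * pi}"
    by (intro has_integral_three_periods) (auto simp: acceleration_periodic[OF \<gamma>])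
  show "(\<integral>\<^sup>+t. ennreal (?F t) * indicator {-3 * pi..3 * pi} t \<partial>lborel) = ennreal (3 * N)"
    by (rule nn_integral_has_integral_lebesgue'[OF _ int]) simp
  have "set_integrable lebesgue {-3 * pi..3 * pi} ?F"
    using int by (intro nonnegative_absolutely_integrable_1) auto
  then have "(\<lambda>t. indicator {-3 * pi..3 * pi} t *\<^sub>R ?F t) \<in> borel_measurable lebesgue"
    unfolding set_integrable_def by (rule borel_measurable_integrable)
  then have "(\<lambda>t. ennreal (indicator {-3 * pi..3 * pi} t *\<^sub>R ?F t)) \<in> borel_measurable lebesgue"
    by (rule measurable_compose[OF _ measurable_ennreal])
  also have "(\<lambda>t. ennreal (indicator {-3 * pi..3 * pi} t *\<^sub>R ?F t)) = (\<lambda>t. ennreal (?F t) * indicator {-3 * pi..3 * pi} t)"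
    by (auto simp: fun_eq_iff indicator_def)
  finally show "(\<lambda>t. ennreal (?F t) * indicator {-3 * pi..3 * pi} t) \<in> borel_measurable lebesgue" .
qed

lemma bending_energy_eq:
  assumes \<gamma>: "closed_constant_speed_curve \<gamma>"
  shows "bending_energy \<gamma> = (total_curvature 2 \<gamma>)\<^sup>2"
proof -
  let ?v = "len \<gamma> / (2 * pi)"
  have sq: "(LINT x:circle|lebesgue. (curvature \<gamma> x)\<^sup>2 * norm (velocity \<gamma> x))
      = (LINT x:circle|lebesgue. curvature \<gamma> x powr 2 * norm (velocity \<gamma> x))"
    by (simp add: curvature_def)
  have "0 \<le> (LINT x:circle|lebesgue. curvature \<gamma> x powr 2 * norm (velocity \<gamma> x))"
    unfolding set_lebesgue_integral_def by (intro Bochner_Integration.integral_nonneg) auto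
  then show ?thesis
    using speed_pos[OF \<gamma>]
    by (simp add: bending_energy_def total_curvature_def sq power_mult_distrib powr_half_sqrt)
qed

section \<open>The bound on the average crossing number\<close>

text \<open>
  The middle factor is the integral of \<open>\<bar>z\<bar> powr (1 - 2 / q)\<close> over \<open>{-pi..pi}\<close>. In the first one,
  \<open>3\<close> counts the periods over which \<open>\<bar>\<gamma>''\<bar> powr q\<close> is integrated, and \<open>2 pi\<close> normalizes the total
  curvature. The remaining constants \<open>3\<close> (cone over the sphere), \<open>2 / 3\<close> (integral of \<open>r\<^sup>2\<close>) and
  \<open>8 pi\<close> combine to \<open>1 / (4 pi)\<close>.
\<close>
definition crossing_constant :: "real \<Rightarrow> real" where
  "crossing_constant q = (6 * pi) powr (2 / q) * (2 * pi powr (2 - 2 / q) / (2 - 2 / q)) / (4 * pi)"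

lemma crossing_constant_pos:
  assumes "1 < q"
  shows "0 < crossing_constant q"
proof -
  have "0 < 2 - 2 / q" using assms by (simp add: divide_less_eq)
  then show ?thesis unfolding crossing_constant_def
    by (intro divide_pos_pos mult_pos_pos) auto
qed

lemma average_crossing_number_le:
  assumes q: "1 < q" "q \<le> 2" and \<gamma>: "closed_constant_speed_curve \<gamma>"
    and fin: "distortion \<gamma> < \<infinity>" and tc: "finite_total_curvature q \<gamma>"
  shows "average_crossing_number \<gamma> \<le> ennreal (crossing_constant q * (total_curvature q \<gamma>)\<^sup>2) * distortion \<gamma> ^ 3"
proof -
  define v where "v = len \<gamma> / (2 * pi)"
  define d where "d = enn2real (distortion \<gamma>)"
  define N where "N = (LINT x:circle|lebesgue. norm (acceleration \<gamma> x) powr q)"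
  define J where "J = 2 * pi powr (2 - 2 / q) / (2 - 2 / q)"
  let ?M = "3 * N" and ?c = "d / v"
  let ?F = "\<lambda>t. ennreal (norm (acceleration \<gamma> t) powr q)"
  have v: "0 < v" unfolding v_def by (rule speed_pos[OF \<gamma>])
  have d: "0 \<le> d" "distortion \<gamma> = ennreal d" using fin by (auto simp: d_def)
  have N: "0 \<le> N" unfolding N_def set_lebesgue_integral_def by (intro Bochner_Integration.integral_nonneg) auto
  have q2: "2 / q < 2" using q by (simp add: divide_less_eq)
  then have J: "0 \<le> J" by (simp add: J_def)
  note acc = nn_integral_acceleration[OF \<gamma> tc, folded N_def]
  obtain h where h[measurable]: "h \<in> borel_measurable borel"
    and AE_h: "AE t in lborel. ?F t * indicator {-3 * pi..3 * pi} t = h t"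
    using completion_ex_borel_measurable[OF acc(2)] by auto
  \<comment> \<open>a Borel version \<open>h\<close> of \<open>\<bar>\<gamma>''\<bar> powr q\<close> is needed for Tonelli in the product space\<close>
  have h_int: "(\<integral>\<^sup>+t. h t \<partial>lborel) = ennreal ?M"
    unfolding acc(1)[symmetric] using AE_h by (intro nn_integral_cong_AE) auto
  have window: "(\<integral>\<^sup>+t. ?F t * indicator (closed_segment x (x + z)) t \<partial>lebesgue)
      = (\<integral>\<^sup>+t. h t * indicator (closed_segment x (x + z)) t \<partial>lborel)" if "x \<in> circle" "z \<in> circle" for x z
  proof -
    have seg: "-3 * pi \<le> t \<and> t \<le> 3 * pi" if t: "t \<in> closed_segment x (x + z)" for t
    proof -
      have "x \<le> t \<or> x + z \<le> t" "t \<le> x \<or> t \<le> x + z"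
        using t by (auto simp: closed_segment_eq_real_ivl split: if_splits)
      then show ?thesis using \<open>x \<in> circle\<close> \<open>z \<in> circle\<close> by auto
    qed
    have "AE t in lborel. ?F t * indicator (closed_segment x (x + z)) t = h t * indicator (closed_segment x (x + z)) t"
      using AE_h
    proof eventually_elim
      case (elim t)
      show ?case
      proof (cases "t \<in> closed_segment x (x + z)")
        case True
        with seg[OF True] elim show ?thesis by simp
      qed simp
    qed
    then show ?thesis
      unfolding nn_integral_completion by (rule nn_integral_cong_AE)
  qed
  let ?S = "{w :: real^3. w $ 1 \<in> circle - {0} \<and> w $ 2 \<in> circle \<and> \<bar>w $ 3\<bar> \<le> ?c / \<bar>w $ 1\<bar>}"
  let ?K = "v * ?M powr (2 / q - 1)"
  let ?g = "\<lambda>w :: real^3. if 0 < \<bar>w $ 1\<bar> \<and> \<bar>w $ 1\<bar> \<le> pi \<and> \<bar>w $ 3\<bar> \<le> ?c / \<bar>w $ 1\<bar>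
      then ennreal (?K * (w $ 3)\<^sup>2 * \<bar>w $ 1\<bar> powr (3 - 2 / q)) *
        (\<integral>\<^sup>+t. h t * indicator (closed_segment (w $ 2) (w $ 2 + w $ 1)) t \<partial>lborel)
      else 0"
  have diff: "\<gamma> differentiable (at t)" for t
    using \<gamma> by (simp add: closed_constant_speed_curve_def)
  have S: "?S \<in> sets lebesgue"
  proof -
    have "{w \<in> space borel. (-pi \<le> w $ 1 \<and> w $ 1 < pi \<and> w $ 1 \<noteq> 0) \<and> (-pi \<le> w $ 2 \<and> w $ 2 < pi) \<and> \<bar>w $ 3\<bar> \<le> ?c / \<bar>w $ 1\<bar>}
      \<in> sets (borel :: (real^3) measure)"
      by measurable
    then have "?S \<in> sets lborel" by simp
    then show ?thesis by (rule sets_completionI_sets)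
  qed
  have chord: "\<bar>z\<bar> \<le> ?c * norm (\<gamma> (x + z) - \<gamma> x)" if "x \<in> circle" "z \<in> circle" "z \<noteq> 0" for x z
    using chord_lower_bound[OF \<gamma> fin that, folded v_def d_def] v by (simp add: field_simps)
  have jac: "ennreal \<bar>det (matrix (secant_deriv \<gamma> w))\<bar> * indicator ?S w \<le> ?g w" for w
  proof (cases "w \<in> ?S")
    case True
    then have w: "w $ 2 \<in> circle" "w $ 1 \<in> circle" "w $ 1 \<noteq> 0" by auto
    have "(\<integral>\<^sup>+t. h t * indicator (closed_segment (w $ 2) (w $ 2 + w $ 1)) t \<partial>lborel) \<le> (\<integral>\<^sup>+t. h t \<partial>lborel)"
      by (intro nn_integral_mono) (auto simp: indicator_def)
    then have "(\<integral>\<^sup>+t. ?F t * indicator (closed_segment (w $ 2) (w $ 2 + w $ 1)) t \<partial>lebesgue) \<le> ennreal ?M"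
      by (simp only: window[OF w(1,2)] h_int)
    from jacobian_secant_le[OF q \<gamma> tc w(3) this] N
    have "ennreal \<bar>det (matrix (secant_deriv \<gamma> w))\<bar> \<le> ennreal (?K * (w $ 3)\<^sup>2 * \<bar>w $ 1\<bar> powr (3 - 2 / q)) *
        (\<integral>\<^sup>+t. h t * indicator (closed_segment (w $ 2) (w $ 2 + w $ 1)) t \<partial>lborel)"
      unfolding window[OF w(1,2)] v_def[symmetric] by simp
    then show ?thesis using True by auto
  qed simp
  have "emeasure (count_space UNIV) (crossings \<gamma> (p /\<^sub>R norm p)) * indicator (ball 0 1 - {0}) p
      \<le> emeasure (count_space UNIV) {w \<in> ?S. secant_map \<gamma> w = p}" for p
  proof (cases "p \<in> ball 0 1 - {0}")
    case True
    then have "indicator (ball 0 1 - {0}) p = (1 :: ennreal)" by (rule indicator_simps)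
    moreover have "emeasure (count_space UNIV) (crossings \<gamma> (p /\<^sub>R norm p))
        \<le> emeasure (count_space UNIV) {w \<in> ?S. secant_map \<gamma> w = p}"
      by (rule emeasure_crossings_le[OF True]) (rule chord)
    ultimately show ?thesis by (simp only: mult_1_right)
  next
    case False
    then have "indicator (ball 0 1 - {0}) p = (0 :: ennreal)" by (rule indicator_simps)
    then show ?thesis by (simp only: mult_zero_right zero_le)
  qed
  then have "(\<integral>\<^sup>+p. emeasure (count_space UNIV) (crossings \<gamma> (p /\<^sub>R norm p)) * indicator (ball 0 1 - {0}) p \<partial>lborel)
      \<le> (\<integral>\<^sup>+p. emeasure (count_space UNIV) {w \<in> ?S. secant_map \<gamma> w = p} \<partial>lborel)"
    by (rule nn_integral_mono)
  also have "\<dots> = (\<integral>\<^sup>+p. emeasure (count_space UNIV) {w \<in> ?S. secant_map \<gamma> w = p} \<partial>lebesgue)"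
    by (rule nn_integral_completion[symmetric])
  also have "\<dots> \<le> (\<integral>\<^sup>+w. ennreal \<bar>det (matrix (secant_deriv \<gamma> w))\<bar> * indicator ?S w \<partial>lebesgue)"
    by (rule area_inequality[OF S has_derivative_secant_map[OF diff]])
  also have "\<dots> \<le> (\<integral>\<^sup>+w. ?g w \<partial>lebesgue)"
    by (rule nn_integral_mono) (rule jac)
  also have "\<dots> = (\<integral>\<^sup>+w. ?g w \<partial>lborel)"
    by (rule nn_integral_completion)
  also have "\<dots> \<le> ennreal (?K * (2 / 3 * ?c ^ 3) * ?M * (2 * pi powr (3 - 2 / q - 1) / (3 - 2 / q - 1)))"
  proof (rule nn_integral_majorant_le[OF h])
    show "(\<integral>\<^sup>+t. h t \<partial>lborel) \<le> ennreal ?M" by (simp only: h_int order_refl)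
  qed (use q2 v d(1) N in simp_all)
  also have "2 * pi powr (3 - 2 / q - 1) / (3 - 2 / q - 1) = J"
    by (simp add: J_def)
  finally have ball: "(\<integral>\<^sup>+p. emeasure (count_space UNIV) (crossings \<gamma> (p /\<^sub>R norm p)) * indicator (ball 0 1 - {0}) p \<partial>lborel)
      \<le> ennreal (?K * (2 / 3 * ?c ^ 3) * ?M * J)" .
  have "(\<integral>\<^sup>+\<sigma>. emeasure (count_space UNIV) (crossings \<gamma> \<sigma>) \<partial>sphere_measure)
      \<le> 3 * ennreal (?K * (2 / 3 * ?c ^ 3) * ?M * J)"
    by (rule order_trans[OF nn_integral_sphere_measure_le mult_left_mono[OF ball]]) simp
  also have "\<dots> = ennreal (3 * (?K * (2 / 3 * ?c ^ 3) * ?M * J))"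
    using v d(1) N J by (subst ennreal_mult) auto
  finally have "average_crossing_number \<gamma> \<le> ennreal (3 * (?K * (2 / 3 * ?c ^ 3) * ?M * J)) / ennreal (8 * pi)"
    unfolding average_crossing_number_def by (rule divide_right_mono_ennreal)
  also have "\<dots> = ennreal (3 * (?K * (2 / 3 * ?c ^ 3) * ?M * J) / (8 * pi))"
    using v d(1) N J by (intro divide_ennreal) auto
  also have "3 * (?K * (2 / 3 * ?c ^ 3) * ?M * J) / (8 * pi) = crossing_constant q * (total_curvature q \<gamma>)\<^sup>2 * d ^ 3"
  proof -
    have M: "?M powr (2 / q - 1) * ?M = ?M powr (2 / q)"
      using N by (cases "N = 0") (simp_all add: powr_diff)
    have scale: "(6 * pi) powr (2 / q) * (N / (2 * pi)) powr (2 / q) = ?M powr (2 / q)"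
      using N by (subst powr_mult[symmetric]) auto
    have cube: "v * ?c ^ 3 = d ^ 3 / v\<^sup>2"
      using v by (simp add: power_divide power3_eq_cube power2_eq_square)
    have "3 * (?K * (2 / 3 * ?c ^ 3) * ?M * J) / (8 * pi) = (?M powr (2 / q - 1) * ?M) * J / (4 * pi) * (v * ?c ^ 3)"
      by simp
    also have "\<dots> = crossing_constant q * ((N / (2 * pi)) powr (2 / q) / v\<^sup>2) * d ^ 3"
      unfolding M scale[symmetric] cube crossing_constant_def J_def[symmetric] by simp
    finally show ?thesis
      using total_curvature_sq[OF \<gamma>, of q] q by (simp add: v_def N_def)
  qed
  also have "ennreal (crossing_constant q * (total_curvature q \<gamma>)\<^sup>2 * d ^ 3)
      = ennreal (crossing_constant q * (total_curvature q \<gamma>)\<^sup>2) * distortion \<gamma> ^ 3"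
    unfolding d(2) ennreal_power[OF d(1)]
    using d(1) crossing_constant_pos[OF q(1)] by (intro ennreal_mult) auto
  finally show ?thesis .
qed

theorem mainTheorem3:
  shows "\<exists>C :: real \<Rightarrow> real.
    (\<forall>q. 1 < q \<and> q \<le> 2 \<longrightarrow>
       0 < C q \<and>
       (\<forall>\<gamma>. closed_constant_speed_curve \<gamma> \<and> distortion \<gamma> < \<infinity> \<and> finite_total_curvature q \<gamma> \<longrightarrow>
          average_crossing_number \<gamma>
            \<le> ennreal (C q * (total_curvature q \<gamma>)\<^sup>2) * distortion \<gamma> ^ 3)) \<and>
    (\<forall>\<gamma>. closed_constant_speed_curve \<gamma> \<and> distortion \<gamma> < \<infinity> \<and> finite_total_curvature 2 \<gamma> \<longrightarrow>
       bending_energy \<gamma> = (total_curvature 2 \<gamma>)\<^sup>2 \<and>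
       average_crossing_number \<gamma> \<le> ennreal (C 2) * distortion \<gamma> ^ 3 * ennreal (bending_energy \<gamma>))"
proof (intro exI[of _ crossing_constant] conjI allI impI; (elim conjE)?)
  fix q :: real assume "1 < q" "q \<le> 2"
  then show "0 < crossing_constant q"
    by (simp add: crossing_constant_pos)
next
  fix q :: real and \<gamma>
  assume "1 < q" "q \<le> 2" "closed_constant_speed_curve \<gamma>" "distortion \<gamma> < \<infinity>" "finite_total_curvature q \<gamma>"
  then show "average_crossing_number \<gamma> \<le> ennreal (crossing_constant q * (total_curvature q \<gamma>)\<^sup>2) * distortion \<gamma> ^ 3"
    by (rule average_crossing_number_le)
next
  fix \<gamma> assume "closed_constant_speed_curve \<gamma>"
  then show "bending_energy \<gamma> = (total_curvature 2 \<gamma>)\<^sup>2"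
    by (rule bending_energy_eq)
next
  fix \<gamma> assume \<gamma>: "closed_constant_speed_curve \<gamma>" "distortion \<gamma> < \<infinity>" "finite_total_curvature 2 \<gamma>"
  have "average_crossing_number \<gamma> \<le> ennreal (crossing_constant 2 * (total_curvature 2 \<gamma>)\<^sup>2) * distortion \<gamma> ^ 3"
    using \<gamma> by (intro average_crossing_number_le) auto
  also have "\<dots> = ennreal (crossing_constant 2) * distortion \<gamma> ^ 3 * ennreal (bending_energy \<gamma>)"
    using crossing_constant_pos[of 2] by (simp add: bending_energy_eq[OF \<gamma>(1)] ennreal_mult mult_ac)
  finally show "average_crossing_number \<gamma> \<le> ennreal (crossing_constant 2) * distortion \<gamma> ^ 3 * ennreal (bending_energy \<gamma>)" .
qed

end
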